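(* Let $A\in\mathbb{R}^{n\times n}$, $B\in\mathbb{R}^{n\times m}$, $Q\in\mathcal{S}^n_+$, $R\in\mathcal{S}^m_{++}$, with $(A,B)$ stabilizable and $(A,\sqrt{Q})$ detectable, let $W=Q\oplus R$, and let $\mu_0\in\mathbb{R}^n$, $\Sigma_0\succ 0$, $\Sigma\succeq 0$ and $X_0=\Sigma_0+\mu_0\mu_0^\top$. Then for every discount factor $r\in(0,1)$ sufficiently close to $1$ (i.e. for all $r\in(r_0,1)$ for some $r_0<1$ depending on the data) the following holds. Consider the optimization problem (Primal Problem) $$J_p=\min_{L\in\mathbb{R}^{m\times n},\ S\in\mathcal{S}^{n+m}}\ \operatorname{tr}(WS)$$ $$\text{s.t.}\quad S\succ 0,\qquad rA_LSA_L^\top+\bar L X_0\bar L^\top+\frac{r}{1-r}\bar L\Sigma\bar L^\top=S,$$ where $A_L=\begin{bmatrix} A & B \\ L A & L B \end{bmatrix}$ and $\bar L=\begin{bmatrix} I_n \\ L \end{bmatrix}$. This problem is equivalent to the SLQ problem of minimizing $J(L,x_0)$ over $L\in\mathcal{L}$ in the following sense: if $(S_p,L_p)$ is the optimal point of the Primal Problem, then $J_p=J^*$ and $L_p=L^*$, where $L^*=\arg\min_{L\in\mathcal{L}}J(L,x_0)$ and $J^*=J(L^*,x_0)$. In addition, the optimal point $(S_p,L_p)$ is unique.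
   Context: $\mathcal{S}^l,\mathcal{S}^l_+,\mathcal{S}^l_{++}$ denote the symmetric, symmetric positive semidefinite, and symmetric positive definite $l\times l$ real matrices; $M\succeq 0$ (resp. $M\succ 0$) means $M\in\mathcal{S}^l_+$ (resp. $\mathcal{S}^l_{++}$). $M_1\oplus M_2$ is the block-diagonal matrix with blocks $M_1,M_2$. System: $x_{k+1}=Ax_k+Bu_k+w_k$, $k\ge 0$, where $x_0\sim\mathcal{N}(\mu_0,\Sigma_0)$, the $w_k\sim\mathcal{N}(0,\Sigma)$ are i.i.d., and $x_0$ is independent of $\{w_k\}$. Thus $X_0=\mathbb{E}[x_0x_0^\top]$. Mean square stability: a system $x_{k+1}=\tilde A x_k+w_k$ is mean square stable (MSS) if for any Gaussian initial state $x_0$ with positive definite covariance matrix and any i.i.d. sequence $\{w_k\}$ of Gaussian vectors with mean zero and positive semidefinite covariance matrix, with $x_0$ independent of $\{w_k\}$, there exist $\mu\in\mathbb{R}^n$, $X\in\mathbb{R}^{n\times n}$ independent of $x_0$ with $\mathbb{E}(x_k)\to\mu$ and $\mathbb{E}(x_kx_k^\top)\to X$ as $k\to\infty$ (equivalently, the spectral radius of $\tilde A$ is less than $1$). $\mathcal{L}$ is the set of stabilizing gains: all $L\in\mathbb{R}^{m\times n}$ such that $x_{k+1}=(A+BL)x_k+w_k$ is MSS. Cost: for $L\in\mathcal{L}$, with the closed loop $u_k=Lx_k$, $$J(L,x_0)=\sum_{k=0}^\infty r^k\,\mathbb{E}\left(\begin{bmatrix} x_k \\ L x_k \end{bmatrix}^\top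 W\begin{bmatrix} x_k \\ L x_k \end{bmatrix}\right).$$ Under the stabilizability and detectability assumptions the minimum over $\mathcal{L}$ exists and is attained at $L^*$.
   Formalization: With S ≻ 0 the Primal Problem is infeasible (every solution S has rank at most n < n+m), so the claims for S ≻ 0 hold only vacuously; the theorem also proves them, with existence of the optimal point, for the constraint S ⪰ 0. *)

theory Defs
  imports "HOL-Probability.Probability"
begin

section \<open>Matrices\<close>

definition psd_mats :: "(real^'k^'k) set" where
  "psd_mats = {M. transpose M = M \<and> (\<forall>x. 0 \<le> x \<bullet> (M *v x))}"

definition pd_mats :: "(real^'k^'k) set" where
  "pd_mats = {M. transpose M = M \<and> (\<forall>x. x \<noteq> 0 \<longrightarrow> 0 < x \<bullet> (M *v x))}"

definition is_psd_sqrt :: "real^'k^'k \<Rightarrow> real^'k^'k \<Rightarrow> bool" where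
  "is_psd_sqrt M C \<longleftrightarrow> C \<in> psd_mats \<and> C ** C = M"

definition outer :: "real^'a \<Rightarrow> real^'b \<Rightarrow> real^'b^'a" where
  "outer x y = (\<chi> i j. x $ i * y $ j)"

definition vec_append :: "'c^'a \<Rightarrow> 'c^'b \<Rightarrow> 'c^('a + 'b)" where
  "vec_append x y = (\<chi> i. case i of Inl a \<Rightarrow> x $ a | Inr b \<Rightarrow> y $ b)"

definition hstack :: "'c^'a^'k \<Rightarrow> 'c^'b^'k \<Rightarrow> 'c^('a + 'b)^'k" where
  "hstack M N = (\<chi> i. vec_append (M $ i) (N $ i))"

text \<open>A matrix is a vector of rows, so appending the outer vectors stacks matrices vertically.\<close>

abbreviation vstack :: "'c^'k^'a \<Rightarrow> 'c^'k^'b \<Rightarrow> 'c^'k^('a + 'b)" where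
  "vstack M N \<equiv> vec_append M N"

definition block_diag :: "real^'a^'a \<Rightarrow> real^'b^'b \<Rightarrow> real^('a + 'b)^('a + 'b)" where
  "block_diag M N = vstack (hstack M 0) (hstack 0 N)"

text \<open>Spectral radius less than one; the eigenvalues of the real matrix are taken over the
  complex numbers.\<close>

definition schur_stable :: "real^'n^'n \<Rightarrow> bool" where
  "schur_stable A \<longleftrightarrow>
     (\<forall>l v. v \<noteq> 0 \<and> map_matrix complex_of_real A *v v = l *s v \<longrightarrow> cmod l < 1)"

definition stabilizable :: "real^'n^'n \<Rightarrow> real^'m^'n \<Rightarrow> bool" where
  "stabilizable A B \<longleftrightarrow> (\<exists>K. schur_stable (A + B ** K))"

definition detectable :: "real^'n^'n \<Rightarrow> real^'n^'p \<Rightarrow> bool" where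
  "detectable A C \<longleftrightarrow> (\<exists>K. schur_stable (A + K ** C))"


section \<open>The stochastic linear system\<close>

text \<open>Multivariate normal distribution with a possibly singular covariance matrix: every linear
  functional is univariate normal, a normal variable of variance zero being a.s. constant.\<close>

definition gaussian :: "'a measure \<Rightarrow> ('a \<Rightarrow> real^'n) \<Rightarrow> real^'n \<Rightarrow> real^'n^'n \<Rightarrow> bool" where
  "gaussian M X \<mu> C \<longleftrightarrow> X \<in> borel_measurable M \<and> C \<in> psd_mats \<and>
     (\<forall>t. if t \<bullet> (C *v t) = 0 then (AE \<omega> in M. t \<bullet> X \<omega> = t \<bullet> \<mu>)
          else distributed M lborel (\<lambda>\<omega>. t \<bullet> X \<omega>)
                 (\<lambda>y. ennreal (normal_density (t \<bullet> \<mu>) (sqrt (t \<bullet> (C *v t))) y)))"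

definition gaussian_noise :: "'a measure \<Rightarrow> (nat \<Rightarrow> 'a \<Rightarrow> real^'n) \<Rightarrow> real^'n^'n \<Rightarrow> bool" where
  "gaussian_noise M w C \<longleftrightarrow>
     (\<forall>k. gaussian M (w k) 0 C) \<and> prob_space.indep_vars M (\<lambda>_. borel) w UNIV"

text \<open>Independence of the generated sigma-algebras; \<open>indep_var\<close> would need both random variables
  to take values in the same type.\<close>

definition indep_of_noise ::
    "'a measure \<Rightarrow> ('a \<Rightarrow> real^'n) \<Rightarrow> (nat \<Rightarrow> 'a \<Rightarrow> real^'n) \<Rightarrow> bool" where
  "indep_of_noise M x0 w \<longleftrightarrow>
     prob_space.indep_set M (sets (vimage_algebra (space M) x0 borel))
       (sets (vimage_algebra (space M) (\<lambda>\<omega> k. w k \<omega>) (\<Pi>\<^sub>M k\<in>UNIV. borel)))"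

primrec state ::
    "real^'n^'n \<Rightarrow> ('a \<Rightarrow> real^'n) \<Rightarrow> (nat \<Rightarrow> 'a \<Rightarrow> real^'n) \<Rightarrow> nat \<Rightarrow> 'a \<Rightarrow> real^'n" where
  "state A x0 w 0 = x0"
| "state A x0 w (Suc k) = (\<lambda>\<omega>. A *v state A x0 w k \<omega> + w k \<omega>)"

text \<open>HOL cannot quantify over all sample spaces inside a definition. The moments depend only on
  the joint law of the initial state and the noise, and every such law lives on the space of
  sequences, which is therefore used as the sample space. The limits may depend on the noise but
  not on the initial state.\<close>

definition mean_square_stable :: "real^'n^'n \<Rightarrow> bool" where
  "mean_square_stable A \<longleftrightarrow>
     (\<forall>(M :: (nat \<Rightarrow> real^'n) measure) w C. prob_space M \<and> gaussian_noise M w C \<longrightarrow>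
        (\<exists>\<mu> X. \<forall>x0 \<mu>0 C0.
            gaussian M x0 \<mu>0 C0 \<and> C0 \<in> pd_mats \<and> indep_of_noise M x0 w \<longrightarrow>
            (\<lambda>k. \<integral>\<omega>. state A x0 w k \<omega> \<partial>M) \<longlonglongrightarrow> \<mu> \<and>
            (\<lambda>k. \<integral>\<omega>. outer (state A x0 w k \<omega>) (state A x0 w k \<omega>) \<partial>M) \<longlonglongrightarrow> X))"

definition stabilizing_gains :: "real^'n^'n \<Rightarrow> real^'m^'n \<Rightarrow> (real^'n^'m) set" where
  "stabilizing_gains A B = {L. mean_square_stable (A + B ** L)}"

definition slq_cost ::
    "'a measure \<Rightarrow> real^'n^'n \<Rightarrow> real^'m^'n \<Rightarrow> real^('n + 'm)^('n + 'm) \<Rightarrow> real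
     \<Rightarrow> ('a \<Rightarrow> real^'n) \<Rightarrow> (nat \<Rightarrow> 'a \<Rightarrow> real^'n) \<Rightarrow> real^'n^'m \<Rightarrow> real" where
  "slq_cost M A B W r x0 w L =
     (\<Sum>k. r ^ k * (\<integral>\<omega>. (let x = state (A + B ** L) x0 w k \<omega>; z = vec_append x (L *v x)
                        in z \<bullet> (W *v z)) \<partial>M))"

definition slq_optimal ::
    "'a measure \<Rightarrow> real^'n^'n \<Rightarrow> real^'m^'n \<Rightarrow> real^('n + 'm)^('n + 'm) \<Rightarrow> real
     \<Rightarrow> ('a \<Rightarrow> real^'n) \<Rightarrow> (nat \<Rightarrow> 'a \<Rightarrow> real^'n) \<Rightarrow> real^'n^'m \<Rightarrow> bool" where
  "slq_optimal M A B W r x0 w L \<longleftrightarrow>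
     is_arg_min (slq_cost M A B W r x0 w) (\<lambda>L. L \<in> stabilizing_gains A B) L"


section \<open>The primal problem\<close>

definition Lbar :: "real^'n^'m \<Rightarrow> real^'n^('n + 'm)" where
  "Lbar L = vstack (mat 1) L"

definition closed_loop ::
    "real^'n^'n \<Rightarrow> real^'m^'n \<Rightarrow> real^'n^'m \<Rightarrow> real^('n + 'm)^('n + 'm)" where
  "closed_loop A B L = vstack (hstack A B) (hstack (L ** A) (L ** B))"

text \<open>The cone \<open>K\<close> containing the variable \<open>S\<close> is a parameter. Every solution \<open>S\<close> of the equation
  factors through \<open>Lbar L\<close>, so it has rank at most \<open>CARD('n)\<close>: with \<open>K = pd_mats\<close> there is no
  feasible point, while \<open>K = psd_mats\<close> gives a solvable problem.\<close>

definition primal_feasible ::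
    "(real^('n + 'm)^('n + 'm)) set \<Rightarrow> real^'n^'n \<Rightarrow> real^'m^'n \<Rightarrow> real^'n^'n \<Rightarrow> real^'n^'n \<Rightarrow> real
     \<Rightarrow> (real^('n + 'm)^('n + 'm)) \<times> (real^'n^'m) \<Rightarrow> bool" where
  "primal_feasible K A B X0 C r = (\<lambda>(S, L). S \<in> K \<and>
     r *\<^sub>R (closed_loop A B L ** S ** transpose (closed_loop A B L))
       + Lbar L ** X0 ** transpose (Lbar L)
       + (r / (1 - r)) *\<^sub>R (Lbar L ** C ** transpose (Lbar L)) = S)"

definition primal_optimal ::
    "(real^('n + 'm)^('n + 'm)) set \<Rightarrow> real^'n^'n \<Rightarrow> real^'m^'n \<Rightarrow> real^('n + 'm)^('n + 'm)
     \<Rightarrow> real^'n^'n \<Rightarrow> real^'n^'n \<Rightarrow> real \<Rightarrow> (real^('n + 'm)^('n + 'm)) \<times> (real^'n^'m) \<Rightarrow> bool" where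
  "primal_optimal K A B W X0 C r =
     is_arg_min (\<lambda>(S, L). trace (W ** S)) (primal_feasible K A B X0 C r)"

end

(* For every gain L' and every Y >= 0 with Y = r (A+BL') Y (A+BL')^T + X, where X = X0 + r/(1-r) Sigma,
   completing the square in the discounted Riccati equation (solution P, gain L, Hessian H) gives
     tr((Q + L'^T R L') Y) = tr(P X) + tr((L'-L)^T H (L'-L) Y).
   The left-hand side is the primal objective at S = [I; L'] Y [I; L']^T and, when A+BL' is stable, the
   SLQ cost, so both problems are minimised exactly at L' = L provided that L is a stabilizing gain.
   This is where r must be close to 1: the bound on P is uniform in r, and by detectability
   Z + gamma P, with Z a Lyapunov matrix of the observer A + K sqrtQ, is then a Lyapunov function of
   A+BL. Expectations enter only through the recursion X' = F X F^T + Sigma of the second moments. *)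

theory Submission
  imports Defs "HOL-Computational_Algebra.Fundamental_Theorem_Algebra"
begin

text \<open>The two problems do not range over the same gains. The primal constraint only asks for a
  positive semidefinite \<open>Y\<close>, which exists as soon as \<open>sqrt r\<close> times
  \<open>A + B ** L'\<close> is stable, whereas the SLQ problem admits only gains that stabilize
  without discount. The completed square therefore serves as a purely algebraic identity, valid at
  every feasible \<open>Y\<close>, and stability has to be established for the single gain
  \<open>L\<close>.

  The uniform bound on \<open>P\<close> is the undiscounted cost matrix of one fixed stabilizing
  gain. It is chosen before \<open>r\<close>, so the threshold can be chosen before \<open>r\<close>
  as well.

  Strictness of the minimum comes from \<open>\<Sigma>0\<close>: every feasible \<open>Y\<close>
  dominates this definite matrix, so a vanishing trace gap forces the gap matrix itself to vanish.

  Eigenvalues enter only at the start. They are traded for decay of orbits, which Lyapunov functions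
  yield, which Stein equations and moment recursions consume, and which is equivalent to mean square
  stability.\<close>

declare transpose_matrix_vector [simp del]

section \<open>Stable matrices and Lyapunov equations\<close>

definition power_stable :: "real^'n^'n \<Rightarrow> bool" where
  "power_stable F \<longleftrightarrow> (\<forall>x. (\<lambda>k. ((*v) F ^^ k) x) \<longlonglongrightarrow> 0)"

section \<open>From eigenvalues to decaying orbits\<close>

lemma exists_linear_dependence:
  fixes f :: "nat \<Rightarrow> 'a::euclidean_space"
  obtains c :: "nat \<Rightarrow> real" where "\<exists>i\<le>DIM('a). c i \<noteq> 0" "(\<Sum>i\<le>DIM('a). c i *\<^sub>R f i) = 0"
proof (cases "inj_on f {..DIM('a)}")
  case True
  then have "card (f ` {..DIM('a)}) > DIM('a)"
    by (simp add: card_image)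
  then have "dependent (f ` {..DIM('a)})"
    by (intro dependent_biggerset) auto
  then obtain u where u: "\<exists>v\<in>f ` {..DIM('a)}. u v \<noteq> 0" "(\<Sum>v\<in>f ` {..DIM('a)}. u v *\<^sub>R v) = 0"
    by (subst (asm) dependent_finite) auto
  show ?thesis
  proof (rule that[of "u \<circ> f"])
    show "\<exists>i\<le>DIM('a). (u \<circ> f) i \<noteq> 0" using u(1) by auto
    show "(\<Sum>i\<le>DIM('a). (u \<circ> f) i *\<^sub>R f i) = 0"
      using u(2) True by (simp add: sum.reindex)
  qed
next
  case False
  then obtain i j where ij: "i \<le> DIM('a)" "j \<le> DIM('a)" "f i = f j" "i \<noteq> j"
    by (auto simp: inj_on_def)
  \<comment> \<open>Dependence is a property of sets, so a repeated vector needs its own relation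
    \<open>f i - f j = 0\<close>.\<close>
  let ?c = "\<lambda>k. (if k = i then 1 else 0) - (if k = j then 1 else (0::real))"
  show ?thesis
  proof (rule that[of ?c])
    show "\<exists>k\<le>DIM('a). ?c k \<noteq> 0" using ij by (intro exI[of _ i]) auto
    have "(\<Sum>k\<le>DIM('a). ?c k *\<^sub>R f k)
        = (\<Sum>k\<le>DIM('a). if k = i then f k else 0) - (\<Sum>k\<le>DIM('a). if k = j then f k else 0)"
      unfolding sum_subtractf[symmetric] by (intro sum.cong) auto
    then show "(\<Sum>k\<le>DIM('a). ?c k *\<^sub>R f k) = 0" using ij by simp
  qed
qed

text \<open>Once the forcing stays below \<open>e / 2 * (1 - cmod l)\<close>, the number
  \<open>e / 2\<close> is the fixed point of the bounding recursion, and what lies above it decays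
  geometrically.\<close>

lemma perturbed_geometric_tendsto_zero:
  fixes a u :: "nat \<Rightarrow> complex"
  assumes rec: "\<And>k. a (Suc k) = l * a k + u k" and l: "cmod l < 1" and u: "u \<longlonglongrightarrow> 0"
  shows "a \<longlonglongrightarrow> 0"
proof (rule LIMSEQ_I)
  fix e :: real assume e: "0 < e"
  let ?l = "cmod l"
  have "0 < e / 2 * (1 - ?l)" using e l by simp
  then obtain N where N: "\<And>k. k \<ge> N \<Longrightarrow> cmod (u k) < e / 2 * (1 - ?l)"
    using LIMSEQ_D[OF u, of "e / 2 * (1 - ?l)"] by auto
  have bd: "cmod (a (N + j)) \<le> ?l ^ j * cmod (a N) + e / 2" for j
  proof (induction j)
    case 0 then show ?case using e by simp
  next
    case (Suc j)
    have "cmod (a (N + Suc j)) \<le> ?l * cmod (a (N + j)) + cmod (u (N + j))"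
      using rec[of "N + j"] norm_triangle_ineq[of "l * a (N + j)" "u (N + j)"]
      by (simp add: norm_mult)
    also have "\<dots> \<le> ?l * (?l ^ j * cmod (a N) + e / 2) + e / 2 * (1 - ?l)"
      using Suc N[of "N + j"] by (intro add_mono mult_left_mono) auto
    finally show ?case by (simp add: field_simps)
  qed
  have "(\<lambda>j. ?l ^ j * cmod (a N)) \<longlonglongrightarrow> 0 * cmod (a N)"
    using l by (intro tendsto_mult LIMSEQ_realpow_zero) auto
  then obtain M where M: "\<And>j. j \<ge> M \<Longrightarrow> ?l ^ j * cmod (a N) < e / 2"
    using LIMSEQ_D[of "\<lambda>j. ?l ^ j * cmod (a N)" 0 "e / 2"] e by auto
  have "norm (a n - 0) < e" if "n \<ge> N + M" for n
  proof -
    have "N + (n - N) = n" "M \<le> n - N" using that by auto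
    then show ?thesis using bd[of "n - N"] M[of "n - N"] by (metis add_strict_right_mono
      diff_zero field_sum_of_halves order_le_less_trans)
  qed
  then show "\<exists>no. \<forall>n\<ge>no. norm (a n - 0) < e" by blast
qed

lemma matrix_vector_mult_sum:
  fixes F :: "'a::ring_1^'n^'m"
  shows "F *v sum f S = (\<Sum>i\<in>S. F *v f i)"
  by (induction S rule: infinite_finite_induct) (auto simp: matrix_vector_right_distrib)

text \<open>The vector \<open>p(F) v\<close>, written directly as a combination of the orbit of
  \<open>v\<close> so that no polynomials of matrices have to be formed.\<close>

definition poly_act :: "complex^'n^'n \<Rightarrow> complex poly \<Rightarrow> complex^'n \<Rightarrow> complex^'n" where
  "poly_act F p v = (\<Sum>i\<le>degree p. coeff p i *s ((*v) F ^^ i) v)"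

lemma poly_act_altdef:
  assumes "degree p \<le> n"
  shows "poly_act F p v = (\<Sum>i\<le>n. coeff p i *s ((*v) F ^^ i) v)"
  unfolding poly_act_def using assms
  by (intro sum.mono_neutral_left) (auto simp: coeff_eq_0)

lemma matrix_vector_mult_funpow_diff_scale:
  fixes F :: "'a::field^'n^'n"
  shows "((*v) F ^^ i) (F *v v - a *s v) = ((*v) F ^^ Suc i) v - a *s ((*v) F ^^ i) v"
  by (induction i) (simp_all add: matrix_vector_mult_diff_distrib vector_scalar_commute)

text \<open>\<open>F\<close> commutes with \<open>q(F)\<close>, so the factor \<open>F - a\<close>
  can act last or first. The first form exhibits \<open>q(F) v\<close> as an eigenvector; the second
  passes from \<open>v\<close> to \<open>(F - a) v\<close> with a shorter annihilating
  polynomial.\<close>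

lemma poly_act_linear_factor:
  fixes F :: "complex^'n^'n"
  shows "poly_act F ([:-a, 1:] * q) v = F *v poly_act F q v - a *s poly_act F q v" (is ?A)
    and "poly_act F ([:-a, 1:] * q) v = poly_act F q (F *v v - a *s v)" (is ?B)
proof -
  let ?n = "degree q" and ?x = "\<lambda>i. ((*v) F ^^ i) v"
  have deg: "degree ([:-a, 1:] * q) \<le> Suc ?n"
    using degree_mult_le[of "[:-a, 1:]" q] by simp
  have cf: "coeff ([:-a, 1:] * q) i = coeff (pCons 0 q) i - a * coeff q i" for i
    by simp
  have "poly_act F ([:-a, 1:] * q) v
      = (\<Sum>i\<le>Suc ?n. coeff (pCons 0 q) i *s ?x i) - (\<Sum>i\<le>Suc ?n. (a * coeff q i) *s ?x i)"
    unfolding poly_act_altdef[OF deg] cf sum_subtractf[symmetric]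
    by (intro sum.cong) (auto simp: vec_eq_iff algebra_simps)
  also have "(\<Sum>i\<le>Suc ?n. coeff (pCons 0 q) i *s ?x i) = (\<Sum>i\<le>?n. coeff q i *s ?x (Suc i))"
    by (subst sum.atMost_Suc_shift) simp
  also have "(\<Sum>i\<le>Suc ?n. (a * coeff q i) *s ?x i) = (\<Sum>i\<le>?n. (a * coeff q i) *s ?x i)"
    by (simp add: coeff_eq_0)
  finally have *: "poly_act F ([:-a, 1:] * q) v
      = (\<Sum>i\<le>?n. coeff q i *s ?x (Suc i)) - (\<Sum>i\<le>?n. (a * coeff q i) *s ?x i)" .
  have "(\<Sum>i\<le>?n. coeff q i *s ?x (Suc i)) = F *v poly_act F q v"
    unfolding poly_act_def by (simp add: matrix_vector_mult_sum vector_scalar_commute)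
  moreover have "(\<Sum>i\<le>?n. (a * coeff q i) *s ?x i) = a *s poly_act F q v"
    unfolding poly_act_def by (simp add: vec_eq_iff sum_distrib_left mult.assoc)
  ultimately show ?A using * by simp
  show ?B
    unfolding * poly_act_def[of F q] matrix_vector_mult_funpow_diff_scale sum_subtractf[symmetric]
    by (intro sum.cong) (auto simp: vec_eq_iff algebra_simps)
qed

text \<open>A replacement for the Jordan form, by splitting off a root \<open>a\<close> of
  \<open>p\<close>. If \<open>cmod a < 1\<close>, the orbit of \<open>(F - a) v\<close> tends to
  zero by induction and is the forcing term of a contraction satisfied by the coordinates of the
  orbit of \<open>v\<close>. Otherwise \<open>q(F) v\<close> would be an eigenvector outside the
  open unit disc, so it vanishes and \<open>q\<close> already annihilates \<open>v\<close>.\<close>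

lemma annihilated_orbit_tendsto_zero:
  fixes F :: "complex^'n^'n"
  assumes spec: "\<And>l v. v \<noteq> 0 \<Longrightarrow> F *v v = l *s v \<Longrightarrow> cmod l < 1"
    and "p \<noteq> 0" "poly_act F p v = 0"
  shows "(\<lambda>k. ((*v) F ^^ k) v) \<longlonglongrightarrow> 0"
  using assms(2,3)
proof (induction "degree p" arbitrary: p v)
  case 0
  then have "coeff p 0 \<noteq> 0" by (metis leading_coeff_0_iff)
  with 0 have "v = 0" by (auto simp: poly_act_def vec_eq_iff)
  moreover have "((*v) F ^^ k) 0 = 0" for k by (induction k) auto
  ultimately show ?case by simp
next
  case (Suc d)
  have "\<not> constant (poly p)" using Suc.hyps(2) by (simp add: constant_degree)
  then obtain a where "poly p a = 0" using fundamental_theorem_of_algebra by blast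
  then obtain q where p: "p = [:-a, 1:] * q" by (auto simp: poly_eq_0_iff_dvd dvd_def)
  have q: "q \<noteq> 0" using p Suc.prems by auto
  have d: "d = degree q" using Suc.hyps(2) q unfolding p by (subst (asm) degree_mult_eq) auto
  show ?case
  proof (cases "cmod a < 1")
    case True
    let ?u = "F *v v - a *s v"
    have "poly_act F q ?u = 0" using Suc.prems unfolding p poly_act_linear_factor(2) by simp
    from Suc.hyps(1)[OF d q this] have u: "(\<lambda>k. ((*v) F ^^ k) ?u) \<longlonglongrightarrow> 0" .
    show ?thesis
    proof (rule vec_tendstoI)
      fix i
      show "(\<lambda>k. ((*v) F ^^ k) v $ i) \<longlonglongrightarrow> 0 $ i"
        unfolding zero_index
      proof (rule perturbed_geometric_tendsto_zero[OF _ True])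
        show "(\<lambda>k. ((*v) F ^^ k) ?u $ i) \<longlonglongrightarrow> 0" using tendsto_vec_nth[OF u, of i] by simp
        show "((*v) F ^^ Suc k) v $ i = a * ((*v) F ^^ k) v $ i + ((*v) F ^^ k) ?u $ i" for k
          unfolding matrix_vector_mult_funpow_diff_scale by simp
      qed
    qed
  next
    case False
    have "F *v poly_act F q v = a *s poly_act F q v"
      using Suc.prems unfolding p poly_act_linear_factor(1) by simp
    then have "poly_act F q v = 0" using spec False by blast
    from Suc.hyps(1)[OF d q this] show ?thesis .
  qed
qed

text \<open>The vectors \<open>x\<close>, \<open>F x\<close>, ... up to the power given by the
  dimension are dependent; the relation is a nonzero polynomial annihilating \<open>x\<close>, which
  is then moved to the complex numbers.\<close>

lemma schur_stable_imp_power_stable: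
  fixes F :: "real^'n^'n"
  assumes "schur_stable F"
  shows "power_stable F"
  unfolding power_stable_def
proof
  fix x :: "real^'n"
  let ?F = "map_matrix complex_of_real F" and ?c = "\<lambda>y::real^'n. (\<chi> i. complex_of_real (y $ i))"
  let ?D = "DIM(real^'n)"
  have step: "?F *v ?c y = ?c (F *v y)" for y
    by (simp add: vec_eq_iff matrix_vector_mult_def map_matrix_def)
  have iter: "((*v) ?F ^^ k) (?c x) = ?c (((*v) F ^^ k) x)" for k
    by (induction k) (simp_all add: step)
  obtain c where c: "\<exists>i\<le>?D. c i \<noteq> 0" "(\<Sum>i\<le>?D. c i *\<^sub>R ((*v) F ^^ i) x) = 0"
    using exists_linear_dependence .
  define p where "p = (\<Sum>i\<le>?D. monom (complex_of_real (c i)) i)"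
  have cf: "coeff p i = (if i \<le> ?D then c i else 0)" for i
    by (simp add: p_def coeff_sum)
  have "p \<noteq> 0" using c(1) cf by (metis coeff_0 of_real_eq_0_iff)
  moreover have "degree p \<le> ?D" by (intro degree_le) (auto simp: cf)
  then have "poly_act ?F p (?c x) = (\<Sum>i\<le>?D. complex_of_real (c i) *s ?c (((*v) F ^^ i) x))"
    by (subst poly_act_altdef, assumption) (auto simp: iter cf intro!: sum.cong)
  then have "poly_act ?F p (?c x) = ?c (\<Sum>i\<le>?D. c i *\<^sub>R ((*v) F ^^ i) x)"
    by (simp add: vec_eq_iff)
  then have "poly_act ?F p (?c x) = 0" unfolding c(2) by (simp add: vec_eq_iff)
  ultimately have "(\<lambda>k. ((*v) ?F ^^ k) (?c x)) \<longlonglongrightarrow> 0"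
    using assms by (intro annihilated_orbit_tendsto_zero[of ?F p]) (auto simp: schur_stable_def)
  then have "(\<lambda>k. ?c (((*v) F ^^ k) x)) \<longlonglongrightarrow> 0" by (simp add: iter)
  then have "(\<lambda>k. Re (?c (((*v) F ^^ k) x) $ i)) \<longlonglongrightarrow> Re ((0::complex^'n) $ i)" for i
    by (intro tendsto_Re tendsto_vec_nth)
  then show "(\<lambda>k. ((*v) F ^^ k) x) \<longlonglongrightarrow> 0" by (intro vec_tendstoI) simp
qed

section \<open>Matrices as bilinear forms\<close>

lemma matrix_eq_bilinear:
  fixes X Y :: "real^'n^'m"
  shows "X = Y \<longleftrightarrow> (\<forall>a b. a \<bullet> (X *v b) = a \<bullet> (Y *v b))"
  by (auto simp: matrix_eq intro: vector_eq_ldot[THEN iffD1])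

lemma matrix_nth_eq_bilinear:
  fixes X :: "real^'n^'m"
  shows "X $ i $ j = axis i 1 \<bullet> (X *v axis j 1)"
  by (simp add: inner_axis' matrix_vector_mult_basis column_def)

lemma inner_matrix_transpose:
  fixes F :: "real^'n^'m"
  shows "a \<bullet> (transpose F *v b) = (F *v a) \<bullet> b"
  by (metis dot_lmul_matrix inner_commute transpose_matrix_vector)

lemma inner_matrix_transpose_left:
  fixes F :: "real^'n^'m"
  shows "(transpose F *v b) \<bullet> a = b \<bullet> (F *v a)"
  by (metis inner_matrix_transpose inner_commute)

text \<open>In the bilinear form a congruence just moves \<open>F\<close> onto both arguments, which
  is why matrix identities and limits are tested on pairs of vectors throughout.\<close>

lemma inner_congruence:
  fixes F :: "real^'n^'m"
  shows "a \<bullet> ((transpose F ** X ** F) *v b) = (F *v a) \<bullet> (X *v (F *v b))"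
  by (metis inner_matrix_transpose matrix_vector_mul_assoc)

lemma inner_congruence_transpose:
  fixes F :: "real^'m^'n"
  shows "a \<bullet> ((F ** X ** transpose F) *v b) = (transpose F *v a) \<bullet> (X *v (transpose F *v b))"
  by (metis inner_congruence transpose_transpose)

lemma inner_funpow_congruence:
  fixes F :: "real^'n^'n"
  shows "a \<bullet> (((\<lambda>X. transpose F ** X ** F) ^^ k) X *v b)
       = ((*v) F ^^ k) a \<bullet> (X *v ((*v) F ^^ k) b)"
proof (induction k arbitrary: a b)
  case (Suc k)
  show ?case using Suc[of "F *v a" "F *v b"] by (simp add: inner_congruence funpow_swap1)
qed simp

lemma matrix_tendstoI:
  fixes X :: "'b \<Rightarrow> real^'n^'m"
  assumes "\<And>a b. ((\<lambda>k. a \<bullet> (X k *v b)) \<longlongrightarrow> a \<bullet> (Y *v b)) G"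
  shows "(X \<longlongrightarrow> Y) G"
  using assms by (intro vec_tendstoI) (simp add: matrix_nth_eq_bilinear)

lemma inner_matrix_vector_sum:
  fixes X :: "real^'n^'m"
  shows "a \<bullet> (X *v b) = (\<Sum>i\<in>UNIV. \<Sum>j\<in>UNIV. a $ i * (X $ i $ j * b $ j))"
  by (simp add: inner_vec_def matrix_vector_mult_def sum_distrib_left)

lemma tendsto_inner_matrix:
  fixes X :: "'b \<Rightarrow> real^'n^'m"
  assumes "(X \<longlongrightarrow> Y) G"
  shows "((\<lambda>k. a \<bullet> (X k *v b)) \<longlongrightarrow> a \<bullet> (Y *v b)) G"
  unfolding inner_matrix_vector_sum by (intro tendsto_intros assms)

lemma power_stable_bilinear_tendsto:
  assumes "power_stable F"
  shows "(\<lambda>k. ((*v) F ^^ k) a \<bullet> (X *v ((*v) F ^^ k) b)) \<longlonglongrightarrow> 0"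
proof -
  have "(\<lambda>k. ((*v) F ^^ k) a \<bullet> (X *v ((*v) F ^^ k) b)) \<longlonglongrightarrow> 0 \<bullet> (X *v 0)"
    using assms unfolding power_stable_def
    by (intro tendsto_inner bounded_linear.tendsto[OF matrix_vector_mul_bounded_linear]) auto
  then show ?thesis by simp
qed

lemma power_stable_congruence_tendsto:
  assumes "power_stable F"
  shows "(\<lambda>k. ((\<lambda>X. transpose F ** X ** F) ^^ k) X) \<longlonglongrightarrow> 0"
  using power_stable_bilinear_tendsto[OF assms]
  by (intro matrix_tendstoI) (simp add: inner_funpow_congruence)

text \<open>Powers of \<open>transpose F\<close> paired with a unit vector become powers of
  \<open>F\<close> applied to that vector, so each coordinate of the orbit decays.\<close>

lemma power_stable_transpose:
  assumes "power_stable F"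
  shows "power_stable (transpose F)"
  unfolding power_stable_def
proof
  fix x
  have *: "a \<bullet> ((*v) (transpose F) ^^ k) b = ((*v) F ^^ k) a \<bullet> b" for a b k
  proof (induction k arbitrary: a)
    case (Suc k)
    show ?case by (simp add: inner_matrix_transpose Suc funpow_swap1[of "(*v) F"])
  qed simp
  show "(\<lambda>k. ((*v) (transpose F) ^^ k) x) \<longlonglongrightarrow> 0"
  proof (rule vec_tendstoI)
    fix i
    have "(\<lambda>k. ((*v) F ^^ k) (axis i 1) \<bullet> x) \<longlonglongrightarrow> 0 \<bullet> x"
      using assms unfolding power_stable_def by (intro tendsto_intros) auto
    then show "(\<lambda>k. ((*v) (transpose F) ^^ k) x $ i) \<longlonglongrightarrow> 0 $ i"
      using *[of "axis i 1" _ x] by (simp add: inner_axis')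
  qed
qed

lemma power_stable_scaleR:
  assumes "power_stable F" "\<bar>c\<bar> \<le> 1"
  shows "power_stable (c *\<^sub>R F)"
  unfolding power_stable_def
proof
  fix x
  have it: "((*v) (c *\<^sub>R F) ^^ k) x = c ^ k *\<^sub>R ((*v) F ^^ k) x" for k
    by (induction k) (simp_all add: scaleR_matrix_vector_assoc[symmetric] matrix_vector_mult_scaleR)
  have "norm (((*v) (c *\<^sub>R F) ^^ k) x) \<le> norm (((*v) F ^^ k) x)" for k
  proof -
    have "\<bar>c\<bar> ^ k \<le> 1" using assms(2) by (intro power_le_one) auto
    then show ?thesis unfolding it norm_scaleR power_abs by (intro mult_left_le_one_le) auto
  qed
  moreover have "(\<lambda>k. norm (((*v) F ^^ k) x)) \<longlonglongrightarrow> 0"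
    using assms(1) by (simp add: power_stable_def tendsto_norm_zero)
  ultimately show "(\<lambda>k. ((*v) (c *\<^sub>R F) ^^ k) x) \<longlonglongrightarrow> 0"
    by (rule Lim_null_comparison[OF always_eventually[OF allI]])
qed

text \<open>The decrements telescope: the sum of \<open>c * (x \<bullet> x)\<close> along an orbit
  never exceeds the initial value of \<open>V\<close>, so its terms tend to zero.\<close>

lemma power_stable_lyapunov_function:
  fixes F :: "real^'n^'n"
  assumes pos: "\<And>x. 0 \<le> V x" and dec: "\<And>x. V (F *v x) \<le> V x - c * (x \<bullet> x)" and c: "0 < c"
  shows "power_stable F"
  unfolding power_stable_def
proof
  fix x
  let ?x = "\<lambda>k. ((*v) F ^^ k) x"
  have "V (?x n) \<le> V x - (\<Sum>k<n. c * (?x k \<bullet> ?x k))" for n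
  proof (induction n)
    case (Suc n) then show ?case using dec[of "?x n"] by simp
  qed simp
  then have "(\<Sum>k<n. c * (?x k \<bullet> ?x k)) \<le> V x" for n
    using pos[of "?x n"] by (smt (verit))
  then have "summable (\<lambda>k. c * (?x k \<bullet> ?x k))"
    using c by (intro bounded_imp_summable[of _ "V x"]) (simp_all add: lessThan_Suc_atMost[symmetric] del: sum.lessThan_Suc)
  then have "(\<lambda>k. c * (?x k \<bullet> ?x k)) \<longlonglongrightarrow> 0" by (rule summable_LIMSEQ_zero)
  then have "(\<lambda>k. inverse c * (c * (?x k \<bullet> ?x k))) \<longlonglongrightarrow> inverse c * 0" by (intro tendsto_intros)
  then have "(\<lambda>k. sqrt (?x k \<bullet> ?x k)) \<longlonglongrightarrow> sqrt 0" using c by (intro tendsto_real_sqrt) simp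
  then show "?x \<longlonglongrightarrow> 0" by (simp add: norm_eq_sqrt_inner[symmetric] tendsto_norm_zero_iff)
qed

section \<open>Stein equations\<close>

lemma stein_equation_unique:
  fixes F :: "real^'n^'n"
  assumes "power_stable F" "X = transpose F ** X ** F + C" "Y = transpose F ** Y ** F + C"
  shows "X = Y"
proof -
  have "transpose F ** (X - Y) ** F = transpose F ** X ** F - transpose F ** Y ** F"
    by (simp add: matrix_eq_bilinear inner_congruence matrix_vector_mult_diff_rdistrib
        inner_diff_right)
  also have "\<dots> = X - Y"
    using assms(2,3) by (metis add_diff_cancel_right)
  finally have lin: "transpose F ** (X - Y) ** F = X - Y" .
  \<comment> \<open>The difference is fixed by a congruence whose iterates tend to zero.\<close>
  have "((\<lambda>X. transpose F ** X ** F) ^^ k) (X - Y) = X - Y" for k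
    by (induction k) (simp_all add: lin)
  then have "(\<lambda>k::nat. X - Y) \<longlonglongrightarrow> 0"
    using power_stable_congruence_tendsto[OF assms(1), of "X - Y"] by simp
  then show ?thesis by (simp add: LIMSEQ_const_iff)
qed

text \<open>Uniqueness makes the linear map \<open>X - transpose F ** X ** F\<close> injective,
  hence surjective in finite dimension; no matrix series has to be summed.\<close>

lemma stein_equation_solvable:
  fixes F :: "real^'n^'n"
  assumes "power_stable F"
  obtains X where "X = transpose F ** X ** F + C"
proof -
  let ?T = "\<lambda>X. X - transpose F ** X ** F"
  have lin: "linear ?T"
    by (rule linearI)
      (simp_all add: matrix_eq_bilinear inner_congruence matrix_vector_mult_diff_rdistrib
        matrix_vector_mult_add_rdistrib inner_diff_right inner_add_right
        scaleR_matrix_vector_assoc[symmetric] right_diff_distrib)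
  have "inj ?T"
  proof (subst linear_injective_0[OF lin], intro allI impI)
    fix X assume "?T X = 0"
    then have "X = transpose F ** X ** F + 0" by simp
    moreover have "0 = transpose F ** 0 ** F + 0" by simp
    ultimately show "X = 0" using stein_equation_unique[OF assms] by blast
  qed
  then have "surj ?T" by (simp add: linear_injective_imp_surjective[OF lin])
  then obtain X where "C = ?T X" by (rule surjE)
  then have "?T X = C" by (rule sym)
  then have "X = transpose F ** X ** F + C" by (simp only: diff_eq_eq add.commute[of C])
  then show ?thesis by (rule that)
qed

text \<open>The transpose solves the same equation, which gives symmetry. Along an orbit of
  \<open>F\<close> the quadratic form of \<open>X\<close> decreases to zero, so it cannot start
  below zero.\<close>

lemma stein_equation_psd:
  fixes F :: "real^'n^'n"
  assumes F: "power_stable F" and X: "X = transpose F ** X ** F + C" and C: "C \<in> psd_mats"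
  shows "X \<in> psd_mats"
proof -
  have "transpose X = transpose F ** transpose X ** F + C"
  proof -
    have "transpose X = transpose (transpose F ** X ** F) + transpose C"
      by (subst X) (simp add: transpose_def vec_eq_iff)
    then show ?thesis using C by (simp add: matrix_transpose_mul matrix_mul_assoc psd_mats_def)
  qed
  then have "transpose X = X" using stein_equation_unique[OF F] X by blast
  moreover have "0 \<le> x \<bullet> (X *v x)" for x
  proof -
    let ?q = "\<lambda>k. ((*v) F ^^ k) x \<bullet> (X *v ((*v) F ^^ k) x)"
    have "?q (Suc k) \<le> ?q k" for k
    proof -
      let ?y = "((*v) F ^^ k) x"
      have "?y \<bullet> (X *v ?y) = (F *v ?y) \<bullet> (X *v (F *v ?y)) + ?y \<bullet> (C *v ?y)"
        by (subst X) (simp add: matrix_vector_mult_add_rdistrib inner_add inner_congruence)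
      then show ?thesis using C by (simp add: psd_mats_def)
    qed
    then have "decseq ?q" by (rule decseq_SucI)
    then have "0 \<le> ?q 0" using power_stable_bilinear_tendsto[OF F] by (rule decseq_ge)
    then show ?thesis by simp
  qed
  ultimately show ?thesis by (simp add: psd_mats_def)
qed

section \<open>Positive semidefinite matrices\<close>

lemma psd_symmetric:
  fixes X :: "real^'n^'n"
  assumes "transpose X = X"
  shows "a \<bullet> (X *v b) = b \<bullet> (X *v a)"
  using inner_matrix_transpose[of a X b] assms by (simp add: inner_commute)

lemma psd_transpose: "X \<in> psd_mats \<Longrightarrow> transpose X = X"
  by (simp add: psd_mats_def)

lemma psd_cauchy_schwarz:
  fixes X :: "real^'n^'n"
  assumes X: "X \<in> psd_mats"
  shows "(x \<bullet> (X *v y))\<^sup>2 \<le> (x \<bullet> (X *v x)) * (y \<bullet> (X *v y))"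
proof -
  let ?a = "x \<bullet> (X *v x)" and ?b = "x \<bullet> (X *v y)" and ?c = "y \<bullet> (X *v y)"
  have sym: "y \<bullet> (X *v x) = ?b" using X by (simp add: psd_symmetric psd_mats_def)
  have q: "0 \<le> ?a + 2 * t * ?b + t\<^sup>2 * ?c" for t
  proof -
    have "0 \<le> (x + t *\<^sub>R y) \<bullet> (X *v (x + t *\<^sub>R y))" using X by (simp add: psd_mats_def)
    also have "\<dots> = ?a + 2 * t * ?b + t\<^sup>2 * ?c"
      by (simp add: matrix_vector_right_distrib matrix_vector_mult_scaleR inner_add sym
          power2_eq_square algebra_simps)
    finally show ?thesis .
  qed
  have c: "0 \<le> ?c" and a: "0 \<le> ?a" using X by (auto simp: psd_mats_def)
  show ?thesis
  proof (cases "?c = 0")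
    case True
    have "?b = 0"
    proof (rule ccontr)
      assume "?b \<noteq> 0"
      \<comment> \<open>This \<open>t\<close> turns \<open>?a + 2 * t * ?b\<close> into
        \<open>-1\<close>.\<close>
      then show False using q[of "- (?a + 1) / (2 * ?b)"] True by (simp add: field_simps)
    qed
    then show ?thesis using True by simp
  next
    case False
    with c have "0 < ?c" by simp
    have "0 \<le> ?a - ?b\<^sup>2 / ?c"
      using q[of "- ?b / ?c"] \<open>0 < ?c\<close> by (simp add: power2_eq_square field_simps)
    then show ?thesis using \<open>0 < ?c\<close> by (simp add: field_simps)
  qed
qed

lemma trace_mult_outer:
  fixes E :: "real^'n^'n"
  shows "trace (E ** outer v v) = v \<bullet> (E *v v)"
proof -
  have "trace (E ** outer v v) = (\<Sum>i\<in>UNIV. \<Sum>k\<in>UNIV. v $ i * (E $ i $ k * v $ k))"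
    unfolding trace_def matrix_matrix_mult_def outer_def
    by (auto intro!: sum.cong simp: mult_ac)
  then show ?thesis by (simp add: inner_matrix_vector_sum)
qed

lemma outer_mult_vec: "outer u v *v x = (v \<bullet> x) *\<^sub>R u"
  by (simp add: outer_def matrix_vector_mult_def inner_vec_def vec_eq_iff sum_distrib_left
      sum_distrib_right mult_ac)

lemma transpose_outer: "transpose (outer u v) = outer v u"
  by (simp add: transpose_def outer_def vec_eq_iff mult.commute)

lemma transpose_add: "transpose (X + Y) = transpose X + transpose Y"
  for X Y :: "'a::semiring_1^'n^'m"
  by (simp add: transpose_def vec_eq_iff)

lemma transpose_minus: "transpose (X - Y) = transpose X - transpose Y"
  for X Y :: "'a::ring_1^'n^'m"
  by (simp add: transpose_def vec_eq_iff)

lemma trace_mult_add: "trace (E ** (X + Y)) = trace (E ** X) + trace (E ** Y)"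
  for E X Y :: "real^'n^'n"
  by (simp add: matrix_add_ldistrib trace_add)

lemma trace_mult_scaleR: "trace (E ** (c *\<^sub>R X)) = c * trace (E ** X)"
  for E X :: "real^'n^'n"
  by (simp add: trace_def matrix_matrix_mult_def sum_distrib_left mult_ac)

lemma psd_add: "X \<in> psd_mats \<Longrightarrow> Y \<in> psd_mats \<Longrightarrow> X + Y \<in> psd_mats"
  by (auto simp: psd_mats_def transpose_add matrix_vector_mult_add_rdistrib inner_add_right)

lemma psd_scaleR: "X \<in> psd_mats \<Longrightarrow> 0 \<le> c \<Longrightarrow> c *\<^sub>R X \<in> psd_mats"
  by (auto simp: psd_mats_def transpose_scalar scaleR_matrix_vector_assoc[symmetric])

lemma psd_congruence:
  fixes F :: "real^'n^'m"
  assumes "X \<in> psd_mats"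
  shows "transpose F ** X ** F \<in> psd_mats"
  unfolding psd_mats_def
proof (intro CollectI conjI allI)
  have X: "transpose X = X" using assms by (simp add: psd_mats_def)
  show "transpose (transpose F ** X ** F) = transpose F ** X ** F"
    by (simp only: X matrix_transpose_mul transpose_transpose matrix_mul_assoc)
  show "0 \<le> x \<bullet> (transpose F ** X ** F *v x)" for x
    using assms unfolding inner_congruence psd_mats_def by simp
qed

lemma psd_congruence_transpose:
  fixes F :: "real^'m^'n"
  assumes "X \<in> psd_mats"
  shows "F ** X ** transpose F \<in> psd_mats"
  using psd_congruence[OF assms, of "transpose F"] by simp

lemma pd_imp_psd: "X \<in> pd_mats \<Longrightarrow> X \<in> psd_mats"
  unfolding pd_mats_def psd_mats_def by (auto, metis inner_zero_left order.refl order.strict_implies_order)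

lemma outer_psd: "outer v v \<in> psd_mats"
  by (auto simp: psd_mats_def transpose_outer outer_mult_vec inner_commute)

text \<open>Eliminating one pivot at a time writes \<open>Y\<close> as a nonnegative combination of matrices
  \<open>outer c c\<close>.\<close>

lemma trace_mult_psd_nonneg:
  fixes E Y :: "real^'n^'n"
  assumes E: "E \<in> psd_mats" and Y: "Y \<in> psd_mats"
  shows "0 \<le> trace (E ** Y)"
proof -
  \<comment> \<open>\<open>S\<close> contains the indices of the rows that may still be nonzero;
    each elimination removes one of them.\<close>
  have "0 \<le> trace (E ** Y)" if "finite S" "Y \<in> psd_mats" "\<And>i j. i \<notin> S \<Longrightarrow> Y $ i $ j = 0"
    for S :: "'n set" and Y
    using that
  proof (induction S arbitrary: Y rule: finite_induct)
    case empty
    then have "Y = 0" by (simp add: vec_eq_iff)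
    then show ?case by (simp add: trace_def)
  next
    case (insert s S)
    let ?e = "axis s 1 :: real^'n"
    let ?c = "Y *v ?e" and ?d = "Y $ s $ s"
    have sym: "transpose Y = Y" using insert.prems by (simp add: psd_mats_def)
    have c: "?c $ i = Y $ i $ s" for i by (simp add: matrix_vector_mult_basis column_def)
    have Ysym: "Y $ s $ i = Y $ i $ s" for i using sym by (simp add: transpose_def vec_eq_iff)
    have d: "?d = ?e \<bullet> (Y *v ?e)" by (rule matrix_nth_eq_bilinear)
    have d0: "0 \<le> ?d" unfolding d using insert.prems by (simp add: psd_mats_def)
    have cs: "(x \<bullet> ?c)\<^sup>2 \<le> (x \<bullet> (Y *v x)) * ?d" for x
      unfolding d using insert.prems(1) by (rule psd_cauchy_schwarz)
    show ?case
    proof (cases "?d = 0")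
      case True
      \<comment> \<open>A zero pivot needs no elimination: Cauchy-Schwarz already forces its whole
        row to vanish.\<close>
      have "(Y $ j $ s)\<^sup>2 \<le> 0" for j
        using cs[of "axis j 1"] unfolding True inner_axis' c by simp
      then have "Y $ s $ j = 0" for j unfolding Ysym by simp
      then have "Y $ i $ j = 0" if "i \<notin> S" for i j
        using insert.prems(2)[of i j] that by (cases "i = s") auto
      then show ?thesis using insert.prems(1) by (intro insert.IH) auto
    next
      case False
      with d0 have dpos: "0 < ?d" by simp
      define Z where "Z = Y - (1 / ?d) *\<^sub>R outer ?c ?c"
      have "Z \<in> psd_mats"
        unfolding psd_mats_def
      proof (intro CollectI conjI allI)
        show "transpose Z = Z"
          unfolding Z_def by (simp add: transpose_minus transpose_scalar transpose_outer sym)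
        fix x
        have "x \<bullet> (Z *v x) = x \<bullet> (Y *v x) - (x \<bullet> ?c)\<^sup>2 / ?d"
          by (simp add: Z_def matrix_vector_mult_diff_rdistrib scaleR_matrix_vector_assoc[symmetric]
              outer_mult_vec inner_diff_right power2_eq_square inner_commute)
        moreover have "(x \<bullet> ?c)\<^sup>2 / ?d \<le> x \<bullet> (Y *v x)"
          using cs[of x] dpos by (simp add: pos_divide_le_eq)
        ultimately show "0 \<le> x \<bullet> (Z *v x)" by simp
      qed
      moreover have "Z $ i $ j = 0" if "i \<notin> S" for i j
      proof (cases "i = s")
        case True
        then show ?thesis using dpos Ysym[of j] c by (simp add: Z_def outer_def)
      next
        case False
        then have "Y $ i $ k = 0" for k using insert.prems that by simp
        then show ?thesis using c by (simp add: Z_def outer_def)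
      qed
      ultimately have "0 \<le> trace (E ** Z)" by (rule insert.IH)
      moreover have "trace (E ** Y) = trace (E ** Z) + (1 / ?d) * trace (E ** outer ?c ?c)"
        unfolding trace_mult_scaleR[symmetric] trace_mult_add[symmetric] Z_def by simp
      moreover have "0 \<le> trace (E ** outer ?c ?c)"
        using E by (simp add: trace_mult_outer psd_mats_def)
      ultimately show ?thesis using dpos by simp
    qed
  qed
  from this[of UNIV Y] Y show ?thesis by simp
qed

lemma matrix_vector_norm_bound:
  fixes B :: "real^'n^'m"
  obtains K where "0 < K" "\<And>x. (B *v x) \<bullet> (B *v x) \<le> K * (x \<bullet> x)"
proof -
  obtain K where K: "0 < K" "\<And>x. norm (B *v x) \<le> norm x * K"
    using bounded_linear.pos_bounded[OF matrix_vector_mul_bounded_linear[of B]] by blast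
  have "(B *v x) \<bullet> (B *v x) \<le> K\<^sup>2 * (x \<bullet> x)" for x
  proof -
    have "(norm (B *v x))\<^sup>2 \<le> (norm x * K)\<^sup>2" using K(2) by (intro power_mono) auto
    then show ?thesis by (simp add: power2_norm_eq_inner power_mult_distrib mult.commute)
  qed
  then show ?thesis using K(1) by (intro that[of "K\<^sup>2"]) auto
qed

lemma matrix_quadratic_bound:
  fixes X :: "real^'n^'n"
  obtains K where "0 < K" "\<And>x. x \<bullet> (X *v x) \<le> K * (x \<bullet> x)"
proof -
  obtain K where K: "0 < K" "\<And>x. norm (X *v x) \<le> norm x * K"
    using bounded_linear.pos_bounded[OF matrix_vector_mul_bounded_linear[of X]] by blast
  have "x \<bullet> (X *v x) \<le> K * (x \<bullet> x)" for x
  proof -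
    have "x \<bullet> (X *v x) \<le> norm x * norm (X *v x)" by (rule norm_cauchy_schwarz)
    also have "\<dots> \<le> norm x * (norm x * K)" using K(2) by (intro mult_left_mono) auto
    finally show ?thesis by (simp add: power2_norm_eq_inner[symmetric] power2_eq_square mult_ac)
  qed
  with K(1) show ?thesis by (rule that)
qed

text \<open>The constant is the minimum of the quadratic form on the unit sphere; homogeneity
  extends the bound to all vectors.\<close>

lemma pd_coercive:
  fixes X :: "real^'n^'n"
  assumes X: "X \<in> pd_mats"
  obtains c where "0 < c" "\<And>x. c * (x \<bullet> x) \<le> x \<bullet> (X *v x)"
proof -
  let ?S = "sphere (0::real^'n) 1"
  have "axis undefined 1 \<in> ?S" by (simp add: dist_norm)
  moreover have "continuous_on ?S (\<lambda>x. x \<bullet> (X *v x))"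
    by (intro continuous_intros linear_continuous_on matrix_vector_mul_bounded_linear)
  ultimately obtain z where z: "z \<in> ?S" "\<And>y. y \<in> ?S \<Longrightarrow> z \<bullet> (X *v z) \<le> y \<bullet> (X *v y)"
    using continuous_attains_inf[of ?S "\<lambda>x. x \<bullet> (X *v x)"] by (metis compact_sphere empty_iff)
  let ?c = "z \<bullet> (X *v z)"
  have "z \<noteq> 0" using z(1) by auto
  then have "0 < ?c" using X by (simp add: pd_mats_def)
  moreover have "?c * (x \<bullet> x) \<le> x \<bullet> (X *v x)" for x
  proof (cases "x = 0")
    case False
    let ?y = "(1 / norm x) *\<^sub>R x"
    have "?c \<le> ?y \<bullet> (X *v ?y)" using False by (intro z(2)) simp
    also have "\<dots> = (x \<bullet> (X *v x)) / (x \<bullet> x)"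
      by (simp add: matrix_vector_mult_scaleR power2_norm_eq_inner[symmetric] power2_eq_square)
    finally show ?thesis using False by (simp add: pos_le_divide_eq)
  qed simp
  ultimately show ?thesis by (rule that)
qed

text \<open>The diagonal entries are nonnegative with sum at most zero, and Cauchy-Schwarz bounds
  the other entries by them.\<close>

lemma psd_zero_trace_imp_zero:
  fixes E :: "real^'n^'n"
  assumes E: "E \<in> psd_mats" and tr: "trace E \<le> 0"
  shows "E = 0"
proof -
  have nn: "0 \<le> E $ i $ i" for i
    using E by (simp add: matrix_nth_eq_bilinear psd_mats_def)
  then have "E $ i $ i = 0" for i
    using tr sum_nonneg_0[of UNIV "\<lambda>i. E $ i $ i" i] sum_nonneg[of UNIV "\<lambda>i. E $ i $ i"]
    by (simp add: trace_def)
  then have "(E $ i $ j)\<^sup>2 \<le> 0" for i j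
    using psd_cauchy_schwarz[OF E, of "axis i 1" "axis j 1"]
    by (simp add: matrix_nth_eq_bilinear[symmetric])
  then show ?thesis by (simp add: vec_eq_iff)
qed

text \<open>A definite \<open>X\<close> below \<open>Y\<close> gives \<open>Y\<close> at least
  \<open>c\<close> times the identity, so \<open>trace (E ** Y)\<close> dominates
  \<open>c * trace E\<close>. This is the source of both uniqueness statements.\<close>

lemma trace_mult_pd_le_0_imp_zero:
  fixes E :: "real^'n^'n"
  assumes E: "E \<in> psd_mats" and X: "X \<in> pd_mats" and YX: "Y - X \<in> psd_mats"
    and tr: "trace (E ** Y) \<le> 0"
  shows "E = 0"
proof -
  obtain c where c: "0 < c" "\<And>x. c * (x \<bullet> x) \<le> x \<bullet> (X *v x)" using pd_coercive[OF X] by blast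
  have "X - c *\<^sub>R mat 1 \<in> psd_mats"
    using X c(2) by (auto simp: psd_mats_def pd_mats_def transpose_minus transpose_scalar
      matrix_vector_mult_diff_rdistrib scaleR_matrix_vector_assoc[symmetric] inner_diff_right)
  then have "0 \<le> trace (E ** ((Y - X) + (X - c *\<^sub>R mat 1)))"
    by (intro trace_mult_psd_nonneg E psd_add YX)
  moreover have "trace (E ** Y) = trace (E ** ((Y - X) + (X - c *\<^sub>R mat 1))) + c * trace (E ** mat 1)"
    unfolding trace_mult_scaleR[symmetric] trace_mult_add[symmetric] by simp
  ultimately have "c * trace E \<le> 0" using tr by simp
  then have "trace E \<le> 0" using c(1) by (simp add: mult_le_0_iff)
  then show ?thesis by (rule psd_zero_trace_imp_zero[OF E])
qed

lemma symmetric_eq_quadratic: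
  fixes X Y :: "real^'n^'n"
  assumes "transpose X = X" "transpose Y = Y" "\<And>x. x \<bullet> (X *v x) = x \<bullet> (Y *v x)"
  shows "X = Y"
  unfolding matrix_eq_bilinear
proof (intro allI)
  fix a b
  have "2 * (a \<bullet> (Z *v b)) = (a + b) \<bullet> (Z *v (a + b)) - a \<bullet> (Z *v a) - b \<bullet> (Z *v b)"
    if "transpose Z = Z" for Z :: "real^'n^'n"
    using psd_symmetric[OF that, of b a] by (simp add: matrix_vector_right_distrib inner_add)
  then show "a \<bullet> (X *v b) = a \<bullet> (Y *v b)" using assms by (metis mult_cancel_left zero_neq_numeral)
qed

section \<open>The discounted Riccati equation\<close>

text \<open>The state-action value of dynamic programming: one stage, then the discounted quadratic
  cost-to-go \<open>P\<close>. The noise would only add a constant.\<close>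

definition bellman ::
    "real \<Rightarrow> real^'n^'n \<Rightarrow> real^'m^'n \<Rightarrow> real^'n^'n \<Rightarrow> real^'m^'m \<Rightarrow> real^'n^'n \<Rightarrow> real^'n \<Rightarrow> real^'m \<Rightarrow> real"
  where "bellman r A B Q R P x u =
    x \<bullet> (Q *v x) + u \<bullet> (R *v u) + r * ((A *v x + B *v u) \<bullet> (P *v (A *v x + B *v u)))"

definition stage_cost :: "real^'n^'n \<Rightarrow> real^'m^'m \<Rightarrow> real^'n^'m \<Rightarrow> real^'n^'n" where
  "stage_cost Q R L = Q + transpose L ** R ** L"

text \<open>Half the second derivative of \<open>bellman\<close> in the control, as \<open>P\<close>
  and \<open>R\<close> are used in symmetric form.\<close>

definition control_hessian :: "real \<Rightarrow> real^'m^'n \<Rightarrow> real^'m^'m \<Rightarrow> real^'n^'n \<Rightarrow> real^'m^'m" where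
  "control_hessian r B R P = R + r *\<^sub>R (transpose B ** P ** B)"

text \<open>Equivalent to \<open>P\<close> solving the algebraic Riccati equation with optimal gain \<open>L\<close>.\<close>

definition riccati ::
    "real \<Rightarrow> real^'n^'n \<Rightarrow> real^'m^'n \<Rightarrow> real^'n^'n \<Rightarrow> real^'m^'m \<Rightarrow> real^'n^'n \<Rightarrow> real^'n^'m \<Rightarrow> bool"
  where "riccati r A B Q R P L \<longleftrightarrow> P \<in> psd_mats \<and>
    (\<forall>x u. bellman r A B Q R P x u =
       x \<bullet> (P *v x) + (u - L *v x) \<bullet> (control_hessian r B R P *v (u - L *v x)))"

lemma stage_cost_psd:
  assumes "Q \<in> psd_mats" "R \<in> psd_mats"
  shows "stage_cost Q R L \<in> psd_mats"
  unfolding stage_cost_def using assms by (intro psd_add psd_congruence)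

lemma inner_stage_cost:
  "x \<bullet> (stage_cost Q R L *v x) = x \<bullet> (Q *v x) + (L *v x) \<bullet> (R *v (L *v x))"
  by (simp add: stage_cost_def matrix_vector_mult_add_rdistrib inner_add_right inner_congruence)

lemma bellman_feedback:
  "bellman r A B Q R P x (L *v x) =
     x \<bullet> ((stage_cost Q R L + r *\<^sub>R (transpose (A + B ** L) ** P ** (A + B ** L))) *v x)"
  by (simp add: bellman_def inner_stage_cost inner_congruence matrix_vector_mult_add_rdistrib
      inner_add_right scaleR_matrix_vector_assoc[symmetric] matrix_vector_mul_assoc)

lemma control_hessian_pd:
  assumes R: "R \<in> pd_mats" and P: "P \<in> psd_mats" and r: "0 \<le> r"
  shows "control_hessian r B R P \<in> pd_mats"
proof -
  have "transpose B ** P ** B \<in> psd_mats" using P by (rule psd_congruence)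
  with R r show ?thesis
    by (auto simp: control_hessian_def psd_mats_def pd_mats_def transpose_add transpose_scalar
        matrix_vector_mult_add_rdistrib inner_add_right scaleR_matrix_vector_assoc[symmetric]
        add_pos_nonneg)
qed

lemma pd_right_inverse:
  fixes H :: "real^'m^'m"
  assumes "H \<in> pd_mats"
  obtains Hi where "H ** Hi = mat 1"
proof -
  have "x = 0" if "H *v x = 0" for x
  proof (rule ccontr)
    assume "x \<noteq> 0"
    then have "0 < x \<bullet> (H *v x)" using assms by (simp add: pd_mats_def)
    then show False using that by simp
  qed
  then obtain Hi where "Hi ** H = mat 1" using matrix_left_invertible_ker[of H] by blast
  then have "H ** Hi = mat 1" by (simp add: matrix_left_right_inverse)
  then show ?thesis by (rule that)
qed

text \<open>For fixed \<open>x\<close> the function is quadratic in \<open>u\<close> with definite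
  Hessian, so it has a minimizer, linear in \<open>x\<close>, and the excess over the minimum is
  exactly the Hessian form of the deviation.\<close>

lemma bellman_complete_square:
  fixes A :: "real^'n^'n" and B :: "real^'m^'n"
  assumes R: "R \<in> pd_mats" and P: "P \<in> psd_mats" and r: "0 \<le> r"
  obtains L :: "real^'n^'m" where "\<And>x u. bellman r A B Q R P x u = bellman r A B Q R P x (L *v x)
     + (u - L *v x) \<bullet> (control_hessian r B R P *v (u - L *v x))"
proof -
  let ?H = "control_hessian r B R P"
  obtain Hi where Hi: "?H ** Hi = mat 1" using pd_right_inverse control_hessian_pd[OF assms] by blast
  define L where "L = - (Hi ** (r *\<^sub>R (transpose B ** P ** A)))"
  have Rs: "transpose R = R" and Ps: "transpose P = P"
    using R P by (auto simp: pd_mats_def psd_mats_def)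
  have HL: "?H *v (L *v x) = - (r *\<^sub>R (transpose B *v (P *v (A *v x))))" for x
  proof -
    have "?H ** L = - (r *\<^sub>R (transpose B ** P ** A))"
    proof -
      have "?H ** L = - (?H ** (Hi ** (r *\<^sub>R (transpose B ** P ** A))))"
        by (simp add: L_def matrix_matrix_mult_def vec_eq_iff sum_negf)
      then show ?thesis by (simp add: matrix_mul_assoc Hi)
    qed
    then have "?H *v (L *v x) = (- (r *\<^sub>R (transpose B ** P ** A))) *v x"
      by (metis matrix_vector_mul_assoc)
    also have "\<dots> = - ((r *\<^sub>R (transpose B ** P ** A)) *v x)"
      by (simp add: matrix_vector_mult_def vec_eq_iff sum_negf)
    also have "(r *\<^sub>R (transpose B ** P ** A)) *v x = r *\<^sub>R (transpose B *v (P *v (A *v x)))"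
      unfolding matrix_vector_mul_assoc matrix_mul_assoc by (simp only: scaleR_matrix_vector_assoc)
    finally show ?thesis .
  qed
  show ?thesis
  proof (rule that)
    fix x u
    define d where "d = u - L *v x"
    have u: "u = L *v x + d" by (simp add: d_def)
    define y where "y = A *v x"
    define l where "l = L *v x"
    have "d \<bullet> (?H *v l) = - (r * ((B *v d) \<bullet> (P *v y)))"
      unfolding l_def y_def HL by (simp add: inner_matrix_transpose)
    \<comment> \<open>The first-order condition at \<open>l\<close>, tested against the deviation
      \<open>d\<close>; it removes all cross terms.\<close>
    then have cross: "d \<bullet> (R *v l) + r * ((B *v d) \<bullet> (P *v (B *v l))) + r * ((B *v d) \<bullet> (P *v y)) = 0"
      by (simp add: control_hessian_def matrix_vector_mult_add_rdistrib inner_add_right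
          scaleR_matrix_vector_assoc[symmetric] inner_congruence)
    have sR: "l \<bullet> (R *v d) = d \<bullet> (R *v l)" by (rule psd_symmetric[OF Rs])
    have sP: "(y + B *v l) \<bullet> (P *v (B *v d)) = (B *v d) \<bullet> (P *v (y + B *v l))"
      by (rule psd_symmetric[OF Ps])
    have hd: "d \<bullet> (?H *v d) = d \<bullet> (R *v d) + r * ((B *v d) \<bullet> (P *v (B *v d)))"
      by (simp add: control_hessian_def matrix_vector_mult_add_rdistrib inner_add_right
          scaleR_matrix_vector_assoc[symmetric] inner_congruence)
    have e1: "(l + d) \<bullet> (R *v (l + d)) = l \<bullet> (R *v l) + 2 * (d \<bullet> (R *v l)) + d \<bullet> (R *v d)"
      using sR by (simp add: matrix_vector_right_distrib inner_add)
    have "y + B *v (l + d) = (y + B *v l) + B *v d" by (simp add: matrix_vector_right_distrib)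
    then have e2: "(y + B *v (l + d)) \<bullet> (P *v (y + B *v (l + d)))
        = (y + B *v l) \<bullet> (P *v (y + B *v l)) + 2 * ((B *v d) \<bullet> (P *v y) + (B *v d) \<bullet> (P *v (B *v l)))
          + (B *v d) \<bullet> (P *v (B *v d))"
      using sP by (simp add: matrix_vector_right_distrib inner_add_left inner_add_right)
    have "bellman r A B Q R P x (l + d) = bellman r A B Q R P x l + d \<bullet> (?H *v d)"
      unfolding bellman_def y_def[symmetric] e1 e2 hd using cross by (simp add: algebra_simps)
    then show "bellman r A B Q R P x u = bellman r A B Q R P x (L *v x)
       + (u - L *v x) \<bullet> (?H *v (u - L *v x))"
      unfolding l_def d_def[symmetric] u[symmetric] by (simp add: u[symmetric])
  qed
qed

section \<open>Subsolutions of the Bellman equation\<close>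

lemma continuous_inner_matrix:
  "continuous_on S (\<lambda>P. a \<bullet> ((P :: real^'n^'m) *v b))"
  unfolding continuous_on_def by (intro ballI tendsto_inner_matrix tendsto_ident_at)

text \<open>The inequality \<open>P \<le> T P\<close> for the Bellman operator \<open>T\<close>.
  Demanding it for every \<open>u\<close> avoids forming the minimum and presents the set as an
  intersection of closed conditions on \<open>P\<close>.\<close>

definition bellman_subsolutions ::
    "real \<Rightarrow> real^'n^'n \<Rightarrow> real^'m^'n \<Rightarrow> real^'n^'n \<Rightarrow> real^'m^'m \<Rightarrow> (real^'n^'n) set"
  where "bellman_subsolutions r A B Q R =
    {P \<in> psd_mats. \<forall>x u. x \<bullet> (P *v x) \<le> bellman r A B Q R P x u}"

text \<open>Along the closed loop of a stabilizing gain the quadratic form of \<open>P - P0\<close>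
  increases, and it tends to zero, so it starts at most at zero. Since \<open>r \<le> 1\<close>, the
  factor \<open>r\<close> may be dropped in this comparison: the bound \<open>P0\<close> is the
  undiscounted cost and does not depend on \<open>r\<close>.\<close>

lemma bellman_subsolution_le:
  assumes P: "P \<in> bellman_subsolutions r A B Q R" and r: "0 \<le> r" "r \<le> 1"
    and F: "power_stable (A + B ** L)"
    and P0: "P0 = transpose (A + B ** L) ** P0 ** (A + B ** L) + stage_cost Q R L"
  shows "x \<bullet> (P *v x) \<le> x \<bullet> (P0 *v x)"
proof -
  let ?F = "A + B ** L"
  let ?d = "\<lambda>k. ((*v) ?F ^^ k) x \<bullet> ((P - P0) *v ((*v) ?F ^^ k) x)"
  have "?d k \<le> ?d (Suc k)" for k
  proof -
    define y where "y = ((*v) ?F ^^ k) x"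
    have Fy: "0 \<le> (?F *v y) \<bullet> (P *v (?F *v y))"
      using P by (auto simp: bellman_subsolutions_def psd_mats_def)
    have "y \<bullet> (P *v y) \<le> bellman r A B Q R P y (L *v y)"
      using P by (simp add: bellman_subsolutions_def)
    also have "\<dots> = y \<bullet> (stage_cost Q R L *v y) + r * ((?F *v y) \<bullet> (P *v (?F *v y)))"
      by (simp add: bellman_feedback matrix_vector_mult_add_rdistrib inner_add_right
          scaleR_matrix_vector_assoc[symmetric] inner_congruence)
    also have "\<dots> \<le> y \<bullet> (stage_cost Q R L *v y) + (?F *v y) \<bullet> (P *v (?F *v y))"
      using Fy r by (simp add: mult_left_le_one_le)
    finally have 1: "y \<bullet> (P *v y) \<le> y \<bullet> (stage_cost Q R L *v y) + (?F *v y) \<bullet> (P *v (?F *v y))" .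
    have "y \<bullet> (P0 *v y) = (?F *v y) \<bullet> (P0 *v (?F *v y)) + y \<bullet> (stage_cost Q R L *v y)"
      by (subst P0) (simp only: matrix_vector_mult_add_rdistrib[of "transpose ?F ** P0 ** ?F"]
        inner_add_right[of y] inner_congruence)
    with 1 have "y \<bullet> ((P - P0) *v y) \<le> (?F *v y) \<bullet> ((P - P0) *v (?F *v y))"
      by (simp add: matrix_vector_mult_diff_rdistrib inner_diff_right)
    then show ?thesis by (simp add: y_def)
  qed
  then have "incseq ?d" by (rule incseq_SucI)
  then have "?d 0 \<le> 0" using power_stable_bilinear_tendsto[OF F] by (rule incseq_le)
  then show ?thesis by (simp add: matrix_vector_mult_diff_rdistrib inner_diff_right)
qed

text \<open>The quadratic bound limits the diagonal entries, and Cauchy-Schwarz passes this on to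
  all entries.\<close>

lemma compact_bellman_subsolutions:
  fixes A :: "real^'n^'n" and B :: "real^'m^'n"
  assumes bd: "\<And>P x. P \<in> bellman_subsolutions r A B Q R \<Longrightarrow> x \<bullet> (P *v x) \<le> p * (x \<bullet> x)"
  shows "compact (bellman_subsolutions r A B Q R)"
proof -
  let ?S = "bellman_subsolutions r A B Q R"
  have "?S = (\<Inter>a b. {P. a \<bullet> (P *v b) = b \<bullet> (P *v a)}) \<inter> (\<Inter>x. {P. 0 \<le> x \<bullet> (P *v x)})
      \<inter> (\<Inter>x u. {P. x \<bullet> (P *v x) \<le> bellman r A B Q R P x u})"
    (is "_ = ?T")
  proof -
    have "transpose P = P \<longleftrightarrow> (\<forall>a b. a \<bullet> (P *v b) = b \<bullet> (P *v a))" for P :: "real^'n^'n"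
      by (auto simp: matrix_eq_bilinear inner_matrix_transpose inner_commute)
    then show ?thesis unfolding bellman_subsolutions_def psd_mats_def by auto
  qed
  moreover have "closed ?T"
    unfolding bellman_def
    by (intro closed_Int closed_INT ballI closed_Collect_eq closed_Collect_le continuous_intros
        continuous_inner_matrix)
  ultimately have "closed ?S" by simp
  moreover have "bounded ?S"
    unfolding bounded_iff
  proof (intro exI ballI)
    fix P assume P: "P \<in> ?S"
    then have psd: "P \<in> psd_mats" by (simp add: bellman_subsolutions_def)
    have diag: "0 \<le> P $ i $ i \<and> P $ i $ i \<le> p" for i
      using bd[OF P, of "axis i 1"] psd
      by (simp add: matrix_nth_eq_bilinear psd_mats_def inner_axis_axis)
    have p: "0 \<le> p" using diag[of undefined] by linarith
    have "\<bar>P $ i $ j\<bar> \<le> p" for i j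
    proof -
      have "(P $ i $ j)\<^sup>2 \<le> P $ i $ i * P $ j $ j"
        using psd_cauchy_schwarz[OF psd, of "axis i 1" "axis j 1"]
        by (simp add: matrix_nth_eq_bilinear[symmetric])
      also have "\<dots> \<le> p\<^sup>2" unfolding power2_eq_square using diag p by (intro mult_mono) auto
      finally show ?thesis using p abs_le_square_iff[of "P $ i $ j" p] by simp
    qed
    then have "norm (P $ i) \<le> (\<Sum>j\<in>(UNIV::'n set). p)" for i
      by (intro order_trans[OF norm_le_l1_cart] sum_mono)
    then show "norm P \<le> (\<Sum>i\<in>(UNIV::'n set). \<Sum>j\<in>(UNIV::'n set). p)"
      unfolding norm_vec_def[of P] by (intro order_trans[OF L2_set_le_sum] sum_mono) auto
  qed
  ultimately show ?thesis by (simp add: compact_eq_bounded_closed)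
qed

text \<open>Among the subsolutions of the Bellman equation the one with the largest trace is a solution,
  since the Bellman operator maps a subsolution to a larger subsolution.\<close>

lemma riccati_exists:
  fixes A :: "real^'n^'n" and B :: "real^'m^'n"
  assumes Q: "Q \<in> psd_mats" and R: "R \<in> pd_mats" and r: "0 \<le> r" "r \<le> 1"
    and F: "power_stable (A + B ** K)"
    and P0: "P0 = transpose (A + B ** K) ** P0 ** (A + B ** K) + stage_cost Q R K"
  obtains P L where "riccati r A B Q R P L" "\<And>x. x \<bullet> (P *v x) \<le> x \<bullet> (P0 *v x)"
proof -
  let ?S = "bellman_subsolutions r A B Q R"
  have Rpsd: "R \<in> psd_mats" using R by (rule pd_imp_psd)
  obtain p where "\<And>x. x \<bullet> (P0 *v x) \<le> p * (x \<bullet> x)" using matrix_quadratic_bound by blast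
  then have bd: "x \<bullet> (P *v x) \<le> p * (x \<bullet> x)" if "P \<in> ?S" for P x
    using bellman_subsolution_le[OF that r F P0, of x] by (meson order_trans)
  have "0 \<in> ?S"
    using Q Rpsd by (simp add: bellman_subsolutions_def bellman_def psd_mats_def transpose_def vec_eq_iff)
  moreover have "continuous_on ?S (trace :: real^'n^'n \<Rightarrow> real)"
    unfolding trace_def by (intro continuous_intros)
  moreover have "compact ?S" using bd by (rule compact_bellman_subsolutions)
  ultimately obtain P where P: "P \<in> ?S" and max: "\<And>Z. Z \<in> ?S \<Longrightarrow> trace Z \<le> trace P"
    using continuous_attains_sup[of ?S trace] by auto
  have psd: "P \<in> psd_mats" using P by (simp add: bellman_subsolutions_def)
  obtain L :: "real^'n^'m" where L: "\<And>x u. bellman r A B Q R P x u = bellman r A B Q R P x (L *v x)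
     + (u - L *v x) \<bullet> (control_hessian r B R P *v (u - L *v x))"
    using bellman_complete_square[OF R psd r(1), of A B Q] by blast
  have H: "0 \<le> d \<bullet> (control_hessian r B R P *v d)" for d
    using pd_imp_psd[OF control_hessian_pd[OF R psd r(1), of B]] by (simp add: psd_mats_def)
  \<comment> \<open>The Bellman operator at \<open>P\<close>, whose minimum over \<open>u\<close> is
    attained at \<open>L *v x\<close>.\<close>
  define Z where "Z = stage_cost Q R L + r *\<^sub>R (transpose (A + B ** L) ** P ** (A + B ** L))"
  have Zpsd: "Z \<in> psd_mats"
    unfolding Z_def using Q Rpsd psd r(1) by (intro psd_add psd_scaleR psd_congruence stage_cost_psd)
  have Z: "bellman r A B Q R P x (L *v x) = x \<bullet> (Z *v x)" for x
    unfolding Z_def by (rule bellman_feedback)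
  have PZ: "x \<bullet> (P *v x) \<le> x \<bullet> (Z *v x)" for x
    using P Z[of x] by (metis (mono_tags, lifting) bellman_subsolutions_def mem_Collect_eq)
  have "Z \<in> ?S"
    unfolding bellman_subsolutions_def
  proof (intro CollectI conjI Zpsd allI)
    fix x u
    have "x \<bullet> (Z *v x) \<le> bellman r A B Q R P x u" using L[of x u] H Z by simp
    also have "\<dots> \<le> bellman r A B Q R Z x u"
      unfolding bellman_def using PZ r(1) by (intro add_left_mono mult_left_mono)
    finally show "x \<bullet> (Z *v x) \<le> bellman r A B Q R Z x u" .
  qed
  then have "trace (Z - P) \<le> 0" using max by (simp add: trace_sub)
  moreover have "Z - P \<in> psd_mats"
    using Zpsd psd PZ by (auto simp: psd_mats_def transpose_minus matrix_vector_mult_diff_rdistrib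
        inner_diff_right)
  ultimately have "Z = P" using psd_zero_trace_imp_zero by fastforce
  then have "riccati r A B Q R P L" using L Z psd by (simp add: riccati_def)
  then show ?thesis using bellman_subsolution_le[OF P r F P0] by (rule that)
qed

text \<open>Inserting \<open>u = L' *v x\<close> into the completed square makes both sides agree as
  quadratic forms; both are symmetric, so they agree as matrices.\<close>

lemma riccati_stage_cost:
  assumes ric: "riccati r A B Q R P L" and Q: "Q \<in> psd_mats" and R: "R \<in> pd_mats" and r: "0 \<le> r"
  shows "stage_cost Q R L' + r *\<^sub>R (transpose (A + B ** L') ** P ** (A + B ** L'))
    = P + transpose (L' - L) ** control_hessian r B R P ** (L' - L)" (is "?X = ?Y")
proof -
  have P: "P \<in> psd_mats" using ric by (simp add: riccati_def)
  have "?X \<in> psd_mats"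
    using Q R P r by (intro psd_add psd_scaleR psd_congruence stage_cost_psd pd_imp_psd[OF R])
  moreover have "?Y \<in> psd_mats"
    using P pd_imp_psd[OF control_hessian_pd[OF R P r]] by (intro psd_add psd_congruence)
  moreover have "x \<bullet> (?X *v x) = x \<bullet> (?Y *v x)" for x
  proof -
    have "x \<bullet> (?X *v x) = bellman r A B Q R P x (L' *v x)" by (rule bellman_feedback[symmetric])
    also have "\<dots> = x \<bullet> (P *v x)
        + (L' *v x - L *v x) \<bullet> (control_hessian r B R P *v (L' *v x - L *v x))"
      using ric by (simp only: riccati_def)
    also have "\<dots> = x \<bullet> (?Y *v x)"
      by (simp only: matrix_vector_mult_add_rdistrib inner_add_right inner_congruence
        matrix_vector_mult_diff_rdistrib)
    finally show ?thesis .
  qed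
  ultimately show ?thesis by (rule symmetric_eq_quadratic[OF psd_transpose psd_transpose])
qed

section \<open>Comparing costs through the Riccati solution\<close>

lemma trace_congruence:
  fixes F :: "real^'n^'n"
  shows "trace (transpose F ** P ** F ** Y) = trace (P ** (F ** Y ** transpose F))"
  by (metis matrix_mul_assoc trace_mul_sym)

lemma trace_add_mult: "trace ((E + E') ** X) = trace (E ** X) + trace (E' ** X)"
  for E E' X :: "real^'n^'n"
  by (simp add: trace_def matrix_matrix_mult_def sum.distrib distrib_right)

lemma trace_scaleR_mult: "trace ((c *\<^sub>R E) ** X) = c * trace (E ** X)"
  for E X :: "real^'n^'n"
  by (simp add: trace_def matrix_matrix_mult_def sum_distrib_left mult_ac)

text \<open>Pairing the matrix identity with \<open>Y\<close> under the trace lets the equation for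
  \<open>Y\<close> cancel the terms in \<open>P\<close> up to \<open>trace (P ** X)\<close>. Only
  this equation enters, so feasible points of the primal problem with a gain that is not stabilizing
  are covered too.\<close>

lemma riccati_cost:
  assumes ric: "riccati r A B Q R P L" and Q: "Q \<in> psd_mats" and R: "R \<in> pd_mats" and r: "0 \<le> r"
    and Y: "Y = r *\<^sub>R ((A + B ** L') ** Y ** transpose (A + B ** L')) + X"
  shows "trace (stage_cost Q R L' ** Y) = trace (P ** X)
     + trace ((transpose (L' - L) ** control_hessian r B R P ** (L' - L)) ** Y)"
proof -
  let ?F = "A + B ** L'"
  have "trace (P ** Y) = r * trace (P ** (?F ** Y ** transpose ?F)) + trace (P ** X)"
    by (subst Y) (simp only: trace_mult_add trace_mult_scaleR)
  moreover have "trace (stage_cost Q R L' ** Y) + r * trace (P ** (?F ** Y ** transpose ?F))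
     = trace (P ** Y) + trace ((transpose (L' - L) ** control_hessian r B R P ** (L' - L)) ** Y)"
    using arg_cong[OF riccati_stage_cost[OF ric Q R r, of L'], of "\<lambda>Z. trace (Z ** Y)"]
    by (simp only: trace_add_mult trace_scaleR_mult trace_congruence)
  ultimately show ?thesis by simp
qed

text \<open>The gap is the trace of a product of two semidefinite matrices. When it is not positive,
  definiteness of \<open>\<Sigma>0\<close> below \<open>Y\<close> kills \<open>?E\<close>, and
  definiteness of the Hessian then kills \<open>L' - L\<close>.\<close>

lemma riccati_optimal:
  assumes ric: "riccati r A B Q R P L" and Q: "Q \<in> psd_mats" and R: "R \<in> pd_mats" and r: "0 \<le> r"
    and Y: "Y = r *\<^sub>R ((A + B ** L') ** Y ** transpose (A + B ** L')) + X" "Y \<in> psd_mats"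
  shows "trace (P ** X) \<le> trace (stage_cost Q R L' ** Y)"
    and "L' = L \<Longrightarrow> trace (stage_cost Q R L' ** Y) = trace (P ** X)"
    and "trace (stage_cost Q R L' ** Y) \<le> trace (P ** X) \<Longrightarrow> \<Sigma>0 \<in> pd_mats \<Longrightarrow> Y - \<Sigma>0 \<in> psd_mats
      \<Longrightarrow> L' = L"
proof -
  let ?H = "control_hessian r B R P" and ?D = "L' - L"
  let ?E = "transpose ?D ** ?H ** ?D"
  note cost = riccati_cost[OF ric Q R r Y(1)]
  have H: "?H \<in> pd_mats" using ric R r by (simp add: riccati_def control_hessian_pd)
  then have E: "?E \<in> psd_mats" by (intro psd_congruence pd_imp_psd)
  show "trace (P ** X) \<le> trace (stage_cost Q R L' ** Y)"
    using cost trace_mult_psd_nonneg[OF E Y(2)] by simp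
  show "trace (stage_cost Q R L' ** Y) = trace (P ** X)" if "L' = L"
    using cost that by (simp add: trace_def)
  assume "trace (stage_cost Q R L' ** Y) \<le> trace (P ** X)" and S: "\<Sigma>0 \<in> pd_mats" "Y - \<Sigma>0 \<in> psd_mats"
  then have "trace (?E ** Y) \<le> 0" using cost by simp
  then have E0: "?E = 0" by (rule trace_mult_pd_le_0_imp_zero[OF E S])
  have "?D *v x = 0" for x
  proof (rule ccontr)
    assume "?D *v x \<noteq> 0"
    then have "0 < (?D *v x) \<bullet> (?H *v (?D *v x))" using H by (simp add: pd_mats_def)
    also have "\<dots> = x \<bullet> (?E *v x)" by (rule inner_congruence[symmetric])
    finally show False by (simp add: E0)
  qed
  then have "?D = 0" by (simp add: matrix_eq)
  then show "L' = L" by simp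
qed

text \<open>With \<open>Z\<close> a Lyapunov matrix of \<open>A + K ** C\<close>, the function \<open>Z + \<gamma> P\<close> is a Lyapunov function
  of the optimal closed loop: detectability lets the stage cost absorb the discrepancy between the
  two dynamics, and discounting costs only \<open>(1 / r - 1) P\<close>.\<close>

lemma riccati_stable_near_one:
  fixes A :: "real^'n^'n" and B :: "real^'m^'n" and C :: "real^'n^'p" and K :: "real^'p^'n"
  assumes G: "power_stable (A + K ** C)" and Q: "Q = transpose C ** C" and R: "R \<in> pd_mats"
    and p: "0 \<le> p"
  obtains r0 where "r0 < 1" "\<And>r P L. r0 < r \<Longrightarrow> 0 < r \<Longrightarrow> r < 1 \<Longrightarrow> riccati r A B Q R P L \<Longrightarrow>
     (\<And>x. x \<bullet> (P *v x) \<le> p * (x \<bullet> x)) \<Longrightarrow> power_stable (A + B ** L)"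
proof -
  let ?G = "A + K ** C"
  obtain Z where Z: "Z = transpose ?G ** Z ** ?G + mat 1" using stein_equation_solvable[OF G] by blast
  have "(mat 1 :: real^'n^'n) \<in> psd_mats" by (simp add: psd_mats_def)
  then have Zpsd: "Z \<in> psd_mats" using stein_equation_psd[OF G Z] by simp
  then have Zpos: "0 \<le> x \<bullet> (Z *v x)" and Zsym: "transpose Z = Z" for x by (auto simp: psd_mats_def)
  obtain c where c: "0 < c" "\<And>x. x \<bullet> (Z *v x) \<le> c * (x \<bullet> x)" using matrix_quadratic_bound by blast
  obtain b where b: "0 < b" "\<And>x. (B *v x) \<bullet> (B *v x) \<le> b * (x \<bullet> x)"
    using matrix_vector_norm_bound by blast
  obtain k where k: "0 < k" "\<And>x. (K *v x) \<bullet> (K *v x) \<le> k * (x \<bullet> x)"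
    using matrix_vector_norm_bound by blast
  obtain \<rho> where \<rho>: "0 < \<rho>" "\<And>x. \<rho> * (x \<bullet> x) \<le> x \<bullet> (R *v x)" using pd_coercive[OF R] by blast
  \<comment> \<open>The last factor bounds \<open>e \<bullet> e\<close> by the stage cost
    \<open>q\<close>, and \<open>c\<close> bounds \<open>Z\<close>. In \<open>1 + 2 * c\<close> the
    \<open>1\<close> pays for the term \<open>e \<bullet> (Z *v e)\<close> itself and
    \<open>2 * c\<close> for the cross term.\<close>
  define \<gamma> where "\<gamma> = (1 + 2 * c) * c * (2 * k + 2 * b / \<rho>)"
  have \<gamma>: "0 < \<gamma>" using c b k \<rho> by (simp add: \<gamma>_def add_pos_pos)
  \<comment> \<open>For positive \<open>r\<close>, the condition \<open>r0 < r\<close> says exactly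
    that \<open>\<gamma> * p * (1 / r - 1) < 1/4\<close>.\<close>
  define r0 where "r0 = (\<gamma> * p) / (\<gamma> * p + 1/4)"
  show ?thesis
  proof (rule that[of r0])
    show "r0 < 1" using \<gamma> p by (simp add: r0_def add_nonneg_pos)
    fix r P L
    assume r: "r0 < r" "0 < r" "r < 1" and ric: "riccati r A B Q R P L"
      and bd: "\<And>x. x \<bullet> (P *v x) \<le> p * (x \<bullet> x)"
    let ?F = "A + B ** L"
    have Ppos: "0 \<le> x \<bullet> (P *v x)" for x using ric by (simp add: riccati_def psd_mats_def)
    have "\<gamma> * p < r * (\<gamma> * p + 1/4)"
      using r(1) \<gamma> p unfolding r0_def by (subst (asm) pos_divide_less_eq) (auto simp: add_nonneg_pos)
    then have rr: "\<gamma> * p * (1 / r - 1) \<le> 1/4" using r by (simp add: field_simps)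
    show "power_stable ?F"
    proof (rule power_stable_lyapunov_function)
      let ?V = "\<lambda>x. x \<bullet> (Z *v x) + \<gamma> * (x \<bullet> (P *v x))"
      show "0 \<le> ?V x" for x using Zpos Ppos \<gamma> by simp
      show "(0::real) < 1/4" by simp
      fix x
      define q where "q = x \<bullet> (Q *v x) + (L *v x) \<bullet> (R *v (L *v x))"
      have Qx: "x \<bullet> (Q *v x) = (C *v x) \<bullet> (C *v x)"
        unfolding Q using inner_congruence[of x C "mat 1" x] by simp
      have q0: "0 \<le> q" unfolding q_def Qx using pd_imp_psd[OF R] by (simp add: psd_mats_def)
      \<comment> \<open>The difference between the optimal closed loop and the observer dynamics; it
        involves \<open>x\<close> only through \<open>L *v x\<close> and \<open>C *v x\<close>, both
        of which the stage cost controls.\<close>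
      define e where "e = B *v (L *v x) - K *v (C *v x)"
      have Fx: "?F *v x = ?G *v x + e"
        by (simp add: e_def matrix_vector_mult_add_rdistrib matrix_vector_mul_assoc)
      have ee: "e \<bullet> e \<le> (2 * k + 2 * b / \<rho>) * q"
      proof -
        let ?f = "B *v (L *v x)" and ?g = "K *v (C *v x)"
        have "0 \<le> (?f + ?g) \<bullet> (?f + ?g)" by simp
        then have "e \<bullet> e \<le> 2 * (?f \<bullet> ?f) + 2 * (?g \<bullet> ?g)"
          by (simp add: e_def inner_add inner_diff inner_commute)
        also have "\<dots> \<le> 2 * (b * ((L *v x) \<bullet> (L *v x))) + 2 * (k * ((C *v x) \<bullet> (C *v x)))"
          using b(2) k(2) by (intro add_mono mult_left_mono) auto
        also have "\<dots> \<le> 2 * (b * (q / \<rho>)) + 2 * (k * q)"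
        proof -
          have "\<rho> * ((L *v x) \<bullet> (L *v x)) \<le> q"
            using \<rho>(2)[of "L *v x"] Qx by (simp add: q_def) (smt (verit) inner_ge_zero)
          then have "(L *v x) \<bullet> (L *v x) \<le> q / \<rho>" using \<rho>(1) by (simp add: field_simps)
          moreover have "(C *v x) \<bullet> (C *v x) \<le> q"
            using pd_imp_psd[OF R] by (simp add: q_def Qx psd_mats_def)
          ultimately show ?thesis using b(1) k(1) by (intro add_mono mult_left_mono) auto
        qed
        finally show ?thesis by (simp add: algebra_simps)
      qed
      have P: "(?F *v x) \<bullet> (P *v (?F *v x)) \<le> x \<bullet> (P *v x) + (1 / r - 1) * (p * (x \<bullet> x)) - q"
      proof -
        have "bellman r A B Q R P x (L *v x) = x \<bullet> (P *v x)"
          using ric by (simp add: riccati_def)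
        then have "q + r * ((?F *v x) \<bullet> (P *v (?F *v x))) = x \<bullet> (P *v x)"
          by (simp add: bellman_def q_def matrix_vector_mult_add_rdistrib matrix_vector_mul_assoc)
        then have "(?F *v x) \<bullet> (P *v (?F *v x)) = (x \<bullet> (P *v x) - q) / r"
          using r by (simp add: field_simps)
        also have "\<dots> = x \<bullet> (P *v x) + (1 / r - 1) * (x \<bullet> (P *v x)) - q / r"
          by (simp add: field_simps diff_divide_distrib)
        also have "\<dots> \<le> x \<bullet> (P *v x) + (1 / r - 1) * (p * (x \<bullet> x)) - q"
          using r q0 bd[of x] by (intro diff_mono add_mono mult_left_mono) (auto simp: field_simps mult_left_le)
        finally show ?thesis .
      qed
      have ZF: "(?F *v x) \<bullet> (Z *v (?F *v x)) \<le> x \<bullet> (Z *v x) - (1/2) * (x \<bullet> x) + \<gamma> * q"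
      proof -
        define g where "g = ?G *v x"
        \<comment> \<open>The weight in Young's inequality. Since
          \<open>g \<bullet> (Z *v g)\<close> is at most \<open>c * (x \<bullet> x)\<close>, it
          costs half of the decay \<open>x \<bullet> x\<close> supplied by \<open>Z\<close>.\<close>
        let ?\<delta> = "1 / (2 * c)"
        have "0 \<le> (?\<delta> *\<^sub>R g - e) \<bullet> (Z *v (?\<delta> *\<^sub>R g - e))" by (rule Zpos)
        also have "\<dots> = ?\<delta>\<^sup>2 * (g \<bullet> (Z *v g)) - 2 * ?\<delta> * (g \<bullet> (Z *v e)) + e \<bullet> (Z *v e)"
          using psd_symmetric[OF Zsym, of e g]
          by (simp add: matrix_vector_mult_diff_distrib matrix_vector_mult_scaleR inner_diff
              power2_eq_square algebra_simps)
        finally have "0 \<le> 2 * c * (?\<delta>\<^sup>2 * (g \<bullet> (Z *v g)) - 2 * ?\<delta> * (g \<bullet> (Z *v e)) + e \<bullet> (Z *v e))"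
          using c(1) by (intro mult_nonneg_nonneg) auto
        also have "\<dots> = ?\<delta> * (g \<bullet> (Z *v g)) - 2 * (g \<bullet> (Z *v e)) + 2 * c * (e \<bullet> (Z *v e))"
          using c(1) by (simp add: power2_eq_square field_simps)
        finally have cross: "2 * (g \<bullet> (Z *v e)) \<le> ?\<delta> * (g \<bullet> (Z *v g)) + 2 * c * (e \<bullet> (Z *v e))"
          by simp
        have gx: "x \<bullet> (Z *v x) = g \<bullet> (Z *v g) + x \<bullet> x"
          unfolding g_def by (subst Z) (simp only: matrix_vector_mult_add_rdistrib[of "transpose ?G ** Z ** ?G"]
            inner_add_right[of x] inner_congruence matrix_vector_mul_lid)
        have "g \<bullet> (Z *v g) \<le> c * (x \<bullet> x)" using gx c(2)[of x] inner_ge_zero[of x] by linarith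
        then have "?\<delta> * (g \<bullet> (Z *v g)) \<le> ?\<delta> * (c * (x \<bullet> x))"
          using c(1) by (intro mult_left_mono) auto
        then have dg: "?\<delta> * (g \<bullet> (Z *v g)) \<le> (1/2) * (x \<bullet> x)" using c(1) by simp
        have "(1 + 2 * c) * (e \<bullet> (Z *v e)) \<le> (1 + 2 * c) * (c * ((2 * k + 2 * b / \<rho>) * q))"
          using c(1) ee by (intro mult_left_mono order_trans[OF c(2)]) auto
        then have ge: "(1 + 2 * c) * (e \<bullet> (Z *v e)) \<le> \<gamma> * q" by (simp add: \<gamma>_def mult.assoc)
        have "(?F *v x) \<bullet> (Z *v (?F *v x)) = g \<bullet> (Z *v g) + 2 * (g \<bullet> (Z *v e)) + e \<bullet> (Z *v e)"
          unfolding Fx g_def[symmetric] using psd_symmetric[OF Zsym, of e g]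
          by (simp add: matrix_vector_right_distrib inner_add)
        with cross dg ge gx show ?thesis by (simp add: distrib_right)
      qed
      \<comment> \<open>In the sum the terms \<open>\<gamma> * q\<close> cancel; of the remaining
        decay \<open>1/2\<close>, discounting takes at most \<open>1/4\<close>.\<close>
      have "\<gamma> * ((?F *v x) \<bullet> (P *v (?F *v x)))
          \<le> \<gamma> * (x \<bullet> (P *v x) + (1 / r - 1) * (p * (x \<bullet> x)) - q)"
        using P \<gamma> by (intro mult_left_mono) auto
      moreover have "\<gamma> * p * (1 / r - 1) * (x \<bullet> x) \<le> 1/4 * (x \<bullet> x)"
        using rr by (intro mult_right_mono) auto
      moreover have "\<gamma> * (x \<bullet> (P *v x) + (1 / r - 1) * (p * (x \<bullet> x)) - q)
          = \<gamma> * (x \<bullet> (P *v x)) + \<gamma> * p * (1 / r - 1) * (x \<bullet> x) - \<gamma> * q"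
        by (simp only: right_diff_distrib distrib_left mult_ac)
      ultimately show "?V (?F *v x) \<le> ?V x - 1/4 * (x \<bullet> x)" using ZF by linarith
    qed
  qed
qed

section \<open>Discounted second moments\<close>

lemma congruence_scaleR:
  fixes F :: "real^'n^'m"
  shows "transpose (c *\<^sub>R F) ** X ** (c *\<^sub>R F) = (c * c) *\<^sub>R (transpose F ** X ** F)"
  by (simp only: matrix_eq_bilinear inner_congruence scaleR_matrix_vector_assoc[symmetric]
      matrix_vector_mult_scaleR inner_scaleR_left inner_scaleR_right mult.assoc simp_thms)

text \<open>The discount is absorbed into the matrix: \<open>sqrt r *\<^sub>R F\<close> is again
  stable and turns this into an ordinary Stein equation.\<close>

lemma discounted_stein_equation:
  fixes F :: "real^'n^'n"
  assumes F: "power_stable F" and r: "0 \<le> r" "r \<le> 1"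
  obtains X where "X = r *\<^sub>R (transpose F ** X ** F) + C" "C \<in> psd_mats \<Longrightarrow> X \<in> psd_mats"
    "\<And>Y. Y = r *\<^sub>R (transpose F ** Y ** F) + C \<Longrightarrow> Y = X"
proof -
  let ?F = "sqrt r *\<^sub>R F"
  have stab: "power_stable ?F" using r by (intro power_stable_scaleR F) simp
  have eq: "r *\<^sub>R (transpose F ** X ** F) = transpose ?F ** X ** ?F" for X
    unfolding congruence_scaleR using r by simp
  obtain X where X: "X = transpose ?F ** X ** ?F + C" using stein_equation_solvable[OF stab, of C] by blast
  show ?thesis
  proof (rule that[of X])
    show "X = r *\<^sub>R (transpose F ** X ** F) + C" unfolding eq by (rule X)
    show "X \<in> psd_mats" if "C \<in> psd_mats" using stab X that by (rule stein_equation_psd)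
    show "Y = X" if "Y = r *\<^sub>R (transpose F ** Y ** F) + C" for Y
      using stab that[unfolded eq] X by (rule stein_equation_unique)
  qed
qed

text \<open>The limit is the Stein solution for \<open>transpose F\<close>, and the deviation from
  it evolves without the constant term. It is obtained before the sequence, hence it is independent
  of \<open>X 0\<close>, as mean square stability demands.\<close>

lemma moment_recursion_tendsto:
  fixes F :: "real^'n^'n"
  assumes F: "power_stable F"
  obtains Xlim where "\<And>X. (\<And>k. X (Suc k) = F ** X k ** transpose F + C) \<Longrightarrow> X \<longlonglongrightarrow> Xlim"
proof -
  have Ft: "power_stable (transpose F)" using F by (rule power_stable_transpose)
  obtain Xl where Xl: "Xl = F ** Xl ** transpose F + C"
    using stein_equation_solvable[OF Ft, of C] unfolding transpose_transpose .
  show ?thesis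
  proof (rule that[of Xl])
    fix X assume rec: "\<And>k. X (Suc k) = F ** X k ** transpose F + C"
    define D where "D = X 0 - Xl"
    have "X k - Xl = ((\<lambda>X. F ** X ** transpose F) ^^ k) D" for k
    proof (induction k)
      case (Suc k)
      have "X (Suc k) - Xl = F ** X k ** transpose F - F ** Xl ** transpose F"
        by (metis Xl rec add_diff_cancel_right)
      also have "\<dots> = F ** (X k - Xl) ** transpose F"
        by (simp only: matrix_eq_bilinear inner_congruence_transpose
            matrix_vector_mult_diff_rdistrib inner_diff_right simp_thms)
      finally show ?case unfolding Suc by simp
    qed (simp add: D_def)
    then have "(\<lambda>k. X k - Xl) \<longlonglongrightarrow> 0"
      using power_stable_congruence_tendsto[OF Ft, of D] by simp
    then show "X \<longlonglongrightarrow> Xl" by (simp add: LIM_zero_iff)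
  qed
qed

lemma trace_mult_tendsto:
  fixes X :: "'b \<Rightarrow> real^'n^'n"
  assumes "(X \<longlongrightarrow> Y) G"
  shows "((\<lambda>k. trace (N ** X k)) \<longlongrightarrow> trace (N ** Y)) G"
  unfolding trace_def matrix_matrix_mult_def by (simp, intro tendsto_intros assms)

text \<open>The dual Lyapunov solution turns the series into a telescoping one.\<close>

lemma discounted_moment_sums:
  fixes F :: "real^'n^'n"
  assumes F: "power_stable F" and r: "0 < r" "r < 1"
    and rec: "\<And>k. X (Suc k) = F ** X k ** transpose F + C"
    and Y: "Y = r *\<^sub>R (F ** Y ** transpose F) + (X 0 + (r / (1 - r)) *\<^sub>R C)"
  shows "(\<lambda>k. r ^ k * trace (N ** X k)) sums trace (N ** Y)"
proof -
  obtain D where D: "D = r *\<^sub>R (transpose F ** D ** F) + N"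
    using discounted_stein_equation[OF F] r by (metis less_imp_le)
  have trN: "trace (N ** Z) = trace (D ** Z) - r * trace (D ** (F ** Z ** transpose F))" for Z
    using arg_cong[OF D, of "\<lambda>V. trace (V ** Z)"]
    by (simp only: trace_add_mult trace_scaleR_mult trace_congruence)
  let ?a = "\<lambda>k. r ^ k * trace (D ** X k)"
  obtain Xl where "X \<longlonglongrightarrow> Xl" using moment_recursion_tendsto[OF F] rec by blast
  then have "?a \<longlonglongrightarrow> 0 * trace (D ** Xl)"
    using r by (intro tendsto_mult LIMSEQ_realpow_zero trace_mult_tendsto) auto
  then have "?a \<longlonglongrightarrow> 0" by simp
  then have "(\<lambda>k. ?a k - ?a (Suc k)) sums (?a 0 - 0)" by (rule telescope_sums')
  \<comment> \<open>The noise entering at each step leaves a geometric series; its sum explains the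
    factor \<open>r / (1 - r)\<close> in the equation for \<open>Y\<close>.\<close>
  moreover have "(\<lambda>k. r ^ k * (r * trace (D ** C))) sums (1 / (1 - r) * (r * trace (D ** C)))"
    using r by (intro sums_mult2 geometric_sums) auto
  ultimately have "(\<lambda>k. ?a k - ?a (Suc k) + r ^ k * (r * trace (D ** C)))
      sums (?a 0 - 0 + 1 / (1 - r) * (r * trace (D ** C)))" by (rule sums_add)
  moreover have "?a k - ?a (Suc k) + r ^ k * (r * trace (D ** C)) = r ^ k * trace (N ** X k)" for k
    unfolding trN rec trace_mult_add by (simp add: algebra_simps)
  moreover have "?a 0 - 0 + 1 / (1 - r) * (r * trace (D ** C)) = trace (N ** Y)"
  proof -
    have "trace (D ** Y) = r * trace (D ** (F ** Y ** transpose F))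
        + (trace (D ** X 0) + (r / (1 - r)) * trace (D ** C))"
      by (subst Y) (simp only: trace_mult_add trace_mult_scaleR)
    then show ?thesis unfolding trN[of Y] by simp
  qed
  ultimately show ?thesis by simp
qed

section \<open>Block matrices and the primal problem\<close>

lemma sum_UNIV_Plus:
  "(\<Sum>i\<in>UNIV. f i) = (\<Sum>i\<in>UNIV. f (Inl i)) + (\<Sum>j\<in>UNIV. f (Inr j))"
  for f :: "'n::finite + 'm::finite \<Rightarrow> 'b::comm_monoid_add"
  unfolding UNIV_Plus_UNIV[symmetric] by (subst sum.Plus) auto

lemma vec_append_nth [simp]:
  "vec_append x y $ Inl i = x $ i" "vec_append x y $ Inr j = y $ j"
  by (simp_all add: vec_append_def)

lemma vec_append_cases:
  obtains x y where "z = vec_append x y"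
proof
  show "z = vec_append (\<chi> i. z $ Inl i) (\<chi> j. z $ Inr j)"
    by (auto simp: vec_append_def vec_eq_iff split: sum.split)
qed

lemma inner_vec_append:
  fixes a c :: "real^'n" and b d :: "real^'m"
  shows "vec_append a b \<bullet> vec_append c d = a \<bullet> c + b \<bullet> d"
  by (simp add: inner_vec_def sum_UNIV_Plus)

lemma hstack_mult_vec:
  fixes M :: "real^'n^'k" and N :: "real^'m^'k"
  shows "hstack M N *v vec_append x y = M *v x + N *v y"
  by (simp add: hstack_def matrix_vector_mult_def vec_eq_iff sum_UNIV_Plus)

lemma vstack_mult_vec:
  fixes M :: "real^'k^'n" and N :: "real^'k^'m"
  shows "vstack M N *v x = vec_append (M *v x) (N *v x)"
  by (auto simp: vec_append_def matrix_vector_mult_def vec_eq_iff split: sum.split)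

lemma vec_append_add: "vec_append (x + u) (y + v) = vec_append x y + vec_append u v"
  by (auto simp: vec_append_def vec_eq_iff split: sum.split)

lemma block_diag_mult_vec: "block_diag Q R *v vec_append x y = vec_append (Q *v x) (R *v y)"
  by (simp add: block_diag_def vstack_mult_vec hstack_mult_vec)

lemma Lbar_mult_vec: "Lbar L *v x = vec_append x (L *v x)"
  by (simp add: Lbar_def vstack_mult_vec)

text \<open>The lower block row is \<open>L\<close> times the upper one. Hence the constraint sees
  \<open>S\<close> only through its congruence by \<open>hstack A B\<close>, a matrix of the size of
  the state.\<close>

lemma closed_loop_factor: "closed_loop A B L = Lbar L ** hstack A B"
proof -
  have "closed_loop A B L *v z = (Lbar L ** hstack A B) *v z" for z
  proof -
    obtain x y where "z = vec_append x y" using vec_append_cases .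
    then show ?thesis
      by (simp add: closed_loop_def vstack_mult_vec hstack_mult_vec matrix_vector_mul_assoc[symmetric]
          Lbar_mult_vec matrix_vector_right_distrib vec_append_add)
  qed
  then show ?thesis by (simp add: matrix_eq)
qed

lemma hstack_Lbar: "hstack A B ** Lbar L = A + B ** L"
  by (simp add: matrix_eq matrix_vector_mul_assoc[symmetric] Lbar_mult_vec hstack_mult_vec
      matrix_vector_mult_add_rdistrib)

lemma Lbar_block_diag: "transpose (Lbar L) ** block_diag Q R ** Lbar L = stage_cost Q R L"
  unfolding matrix_eq_bilinear inner_congruence
  by (simp add: Lbar_mult_vec block_diag_mult_vec inner_vec_append stage_cost_def
      matrix_vector_mult_add_rdistrib inner_add_right inner_congruence)

lemma trace_mult_commute:
  fixes X :: "real^'n^'m" and Y :: "real^'m^'n"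
  shows "trace (X ** Y) = trace (Y ** X)"
  unfolding trace_def matrix_matrix_mult_def
  by (simp add: mult.commute) (rule sum.swap)

lemma trace_block_diag_Lbar:
  "trace (block_diag Q R ** (Lbar L ** Y ** transpose (Lbar L))) = trace (stage_cost Q R L ** Y)"
proof -
  have "trace (block_diag Q R ** (Lbar L ** Y ** transpose (Lbar L)))
      = trace ((block_diag Q R ** Lbar L ** Y) ** transpose (Lbar L))"
    by (simp only: matrix_mul_assoc)
  also have "\<dots> = trace (transpose (Lbar L) ** (block_diag Q R ** Lbar L ** Y))"
    by (rule trace_mult_commute)
  finally show ?thesis by (simp only: matrix_mul_assoc Lbar_block_diag[symmetric])
qed

text \<open>All three terms of the constraint are congruences by \<open>Lbar L\<close>, and
  \<open>Y\<close> collects what stands between the outer factors. The cone plays no part yet, so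
  this serves both cones.\<close>

lemma primal_feasible_factor:
  assumes "primal_feasible K A B X0 C r (S, L)"
  obtains Y where "Y = r *\<^sub>R (hstack A B ** S ** transpose (hstack A B)) + (X0 + (r / (1 - r)) *\<^sub>R C)"
    "S = Lbar L ** Y ** transpose (Lbar L)"
proof (rule that, rule refl)
  have S: "S = r *\<^sub>R (closed_loop A B L ** S ** transpose (closed_loop A B L))
       + Lbar L ** X0 ** transpose (Lbar L)
       + (r / (1 - r)) *\<^sub>R (Lbar L ** C ** transpose (Lbar L))"
    using assms by (simp add: primal_feasible_def)
  have c: "closed_loop A B L ** S ** transpose (closed_loop A B L)
     = Lbar L ** (hstack A B ** S ** transpose (hstack A B)) ** transpose (Lbar L)"
    by (simp only: closed_loop_factor matrix_transpose_mul matrix_mul_assoc)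
  show "S = Lbar L ** (r *\<^sub>R (hstack A B ** S ** transpose (hstack A B)) + (X0 + (r / (1 - r)) *\<^sub>R C))
       ** transpose (Lbar L)"
    by (rule trans[OF S], unfold c)
      (simp only: matrix_eq_bilinear inner_congruence_transpose[of _ "Lbar L"] matrix_vector_mult_add_rdistrib
        inner_add_right scaleR_matrix_vector_assoc[symmetric] inner_scaleR_right add.assoc simp_thms)
qed

text \<open>Since \<open>hstack A B ** Lbar L = A + B ** L\<close>, the constraint reduces to a
  discounted Stein equation for \<open>Y\<close>. Semidefiniteness passes from \<open>S\<close> to
  \<open>Y\<close> through the formula for \<open>Y\<close> as a congruence of \<open>S\<close> plus
  a semidefinite matrix.\<close>

lemma primal_feasible_psd_iff:
  assumes X: "X0 + (r / (1 - r)) *\<^sub>R C \<in> psd_mats" and r: "0 \<le> r"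
  shows "primal_feasible psd_mats A B X0 C r (S, L) \<longleftrightarrow>
    (\<exists>Y \<in> psd_mats. S = Lbar L ** Y ** transpose (Lbar L) \<and>
       Y = r *\<^sub>R ((A + B ** L) ** Y ** transpose (A + B ** L)) + (X0 + (r / (1 - r)) *\<^sub>R C))"
    (is "?l \<longleftrightarrow> ?r")
proof -
  let ?AB = "hstack A B" and ?F = "A + B ** L"
  have ABS: "?AB ** (Lbar L ** Y ** transpose (Lbar L)) ** transpose ?AB = ?F ** Y ** transpose ?F" for Y
    unfolding hstack_Lbar[symmetric] by (simp only: matrix_transpose_mul matrix_mul_assoc)
  show ?thesis
  proof
    assume feas: ?l
    then obtain Y where Y: "Y = r *\<^sub>R (?AB ** S ** transpose ?AB) + (X0 + (r / (1 - r)) *\<^sub>R C)"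
      and S: "S = Lbar L ** Y ** transpose (Lbar L)" by (rule primal_feasible_factor)
    have "S \<in> psd_mats" using feas by (simp add: primal_feasible_def)
    then have "Y \<in> psd_mats"
      using r by (subst Y) (intro psd_add[OF _ X] psd_scaleR psd_congruence_transpose)
    moreover have "Y = r *\<^sub>R (?F ** Y ** transpose ?F) + (X0 + (r / (1 - r)) *\<^sub>R C)"
      using Y unfolding S ABS .
    ultimately show ?r using S by blast
  next
    assume ?r
    then obtain Y where psd: "Y \<in> psd_mats" and S: "S = Lbar L ** Y ** transpose (Lbar L)"
      and Y: "Y = r *\<^sub>R (?F ** Y ** transpose ?F) + (X0 + (r / (1 - r)) *\<^sub>R C)" by blast
    have c: "closed_loop A B L ** S ** transpose (closed_loop A B L)
       = Lbar L ** (?F ** Y ** transpose ?F) ** transpose (Lbar L)"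
      unfolding S ABS[symmetric] by (simp only: closed_loop_factor matrix_transpose_mul matrix_mul_assoc)
    have "S = Lbar L ** (r *\<^sub>R (?F ** Y ** transpose ?F) + (X0 + (r / (1 - r)) *\<^sub>R C))
       ** transpose (Lbar L)"
      using S Y by simp
    also have "\<dots> = r *\<^sub>R (closed_loop A B L ** S ** transpose (closed_loop A B L))
       + Lbar L ** X0 ** transpose (Lbar L)
       + (r / (1 - r)) *\<^sub>R (Lbar L ** C ** transpose (Lbar L))"
      unfolding c
      by (simp only: matrix_eq_bilinear inner_congruence_transpose[of _ "Lbar L"] matrix_vector_mult_add_rdistrib
        inner_add_right scaleR_matrix_vector_assoc[symmetric] inner_scaleR_right add.assoc simp_thms)
    finally have "r *\<^sub>R (closed_loop A B L ** S ** transpose (closed_loop A B L))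
       + Lbar L ** X0 ** transpose (Lbar L)
       + (r / (1 - r)) *\<^sub>R (Lbar L ** C ** transpose (Lbar L)) = S" by (rule sym)
    moreover have "S \<in> psd_mats" unfolding S using psd by (rule psd_congruence_transpose)
    ultimately show ?l by (simp add: primal_feasible_def)
  qed
qed

lemma primal_infeasible_pd: "\<not> primal_feasible pd_mats A B X0 C r (S, L)"
proof
  assume feas: "primal_feasible pd_mats A B X0 C r (S, L)"
  then obtain Y where S: "S = Lbar L ** Y ** transpose (Lbar L)" by (rule primal_feasible_factor)
  define y where "y = (axis undefined 1 :: real^'b)"
  \<comment> \<open>A nonzero vector orthogonal to the range of \<open>Lbar L\<close>, on which the
    quadratic form of \<open>S\<close> must vanish.\<close>
  define z where "z = vec_append (- (transpose L *v y)) y"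
  have "y \<noteq> 0" by (simp add: y_def axis_eq_0_iff)
  then have "z \<noteq> 0" unfolding z_def by (metis vec_append_nth(2) vec_eq_iff zero_index)
  then have "0 < z \<bullet> (S *v z)" using feas by (simp add: primal_feasible_def pd_mats_def)
  moreover have "x \<bullet> (transpose (Lbar L) *v z) = 0" for x
    by (simp add: inner_matrix_transpose Lbar_mult_vec z_def inner_vec_append)
  then have "transpose (Lbar L) *v z = 0" by (metis inner_eq_zero_iff)
  then have "z \<bullet> (S *v z) = 0" unfolding S inner_congruence_transpose by simp
  ultimately show False by simp
qed

section \<open>Moments of the closed-loop state\<close>

lemma (in prob_space) normal_second_moment:
  assumes \<sigma>: "0 < \<sigma>" and D: "distributed M lborel X (\<lambda>x. ennreal (normal_density \<mu> \<sigma> x))"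
  shows "integrable M X" "integrable M (\<lambda>x. (X x)\<^sup>2)" "expectation (\<lambda>x. (X x)\<^sup>2) = \<sigma>\<^sup>2 + \<mu>\<^sup>2"
proof -
  show X: "integrable M X"
    using D by (rule distributed_integrable_var) (simp_all add: integrable_normal_moment_nz_1[OF \<sigma>])
  have "integrable M (\<lambda>x. (X x - \<mu>)\<^sup>2)"
    using distributed_integrable[OF D, of "\<lambda>x. (x - \<mu>)\<^sup>2"] integrable_normal_moment[OF \<sigma>, of \<mu> 2]
    by simp
  then have "integrable M (\<lambda>x. (X x - \<mu>)\<^sup>2 + 2 * \<mu> * X x - \<mu>\<^sup>2)" using X by simp
  then show X2: "integrable M (\<lambda>x. (X x)\<^sup>2)" by (simp add: power2_diff algebra_simps power2_eq_square)
  show "expectation (\<lambda>x. (X x)\<^sup>2) = \<sigma>\<^sup>2 + \<mu>\<^sup>2"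
    using variance_eq[OF X X2] normal_distributed_variance[OF \<sigma> D] normal_distributed_expectation[OF \<sigma> D]
    by simp
qed

text \<open>Directions of variance zero have no density and are almost surely constant; the others
  reduce to the univariate normal law.\<close>

lemma (in prob_space) gaussian_inner_moments:
  assumes G: "gaussian M X \<mu> C"
  shows "integrable M (\<lambda>\<omega>. (t \<bullet> X \<omega>)\<^sup>2)" "expectation (\<lambda>\<omega>. t \<bullet> X \<omega>) = t \<bullet> \<mu>"
    "expectation (\<lambda>\<omega>. (t \<bullet> X \<omega>)\<^sup>2) = t \<bullet> (C *v t) + (t \<bullet> \<mu>)\<^sup>2"
proof -
  have [measurable]: "X \<in> borel_measurable M" using G by (simp add: gaussian_def)
  have nn: "0 \<le> t \<bullet> (C *v t)" using G by (simp add: gaussian_def psd_mats_def)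
  have "integrable M (\<lambda>\<omega>. (t \<bullet> X \<omega>)\<^sup>2) \<and> expectation (\<lambda>\<omega>. t \<bullet> X \<omega>) = t \<bullet> \<mu> \<and>
     expectation (\<lambda>\<omega>. (t \<bullet> X \<omega>)\<^sup>2) = t \<bullet> (C *v t) + (t \<bullet> \<mu>)\<^sup>2"
  proof (cases "t \<bullet> (C *v t) = 0")
    case True
    then have ae: "AE \<omega> in M. t \<bullet> X \<omega> = t \<bullet> \<mu>" using G by (simp add: gaussian_def)
    then have ae2: "AE \<omega> in M. (t \<bullet> X \<omega>)\<^sup>2 = (t \<bullet> \<mu>)\<^sup>2" by eventually_elim simp
    have "integrable M (\<lambda>\<omega>. (t \<bullet> X \<omega>)\<^sup>2) \<longleftrightarrow> integrable M (\<lambda>\<omega>. (t \<bullet> \<mu>)\<^sup>2)"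
      by (intro integrable_cong_AE ae2) auto
    moreover have "expectation (\<lambda>\<omega>. (t \<bullet> X \<omega>)\<^sup>2) = expectation (\<lambda>\<omega>. (t \<bullet> \<mu>)\<^sup>2)"
      by (intro integral_cong_AE ae2) auto
    moreover have "expectation (\<lambda>\<omega>. t \<bullet> X \<omega>) = expectation (\<lambda>\<omega>. t \<bullet> \<mu>)"
      by (intro integral_cong_AE ae) auto
    ultimately show ?thesis using True by (simp add: prob_space)
  next
    case False
    with nn have pos: "0 < sqrt (t \<bullet> (C *v t))" by simp
    have D: "distributed M lborel (\<lambda>\<omega>. t \<bullet> X \<omega>)
        (\<lambda>y. ennreal (normal_density (t \<bullet> \<mu>) (sqrt (t \<bullet> (C *v t))) y))"
      using G False unfolding gaussian_def by metis
    show ?thesis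
      using normal_second_moment[OF pos D] normal_distributed_expectation[OF pos D] nn by simp
  qed
  then show "integrable M (\<lambda>\<omega>. (t \<bullet> X \<omega>)\<^sup>2)" "expectation (\<lambda>\<omega>. t \<bullet> X \<omega>) = t \<bullet> \<mu>"
    "expectation (\<lambda>\<omega>. (t \<bullet> X \<omega>)\<^sup>2) = t \<bullet> (C *v t) + (t \<bullet> \<mu>)\<^sup>2" by auto
qed

definition square_integrable :: "'a measure \<Rightarrow> ('a \<Rightarrow> real^'n) \<Rightarrow> bool" where
  "square_integrable M X \<longleftrightarrow> X \<in> borel_measurable M \<and> integrable M (\<lambda>\<omega>. X \<omega> \<bullet> X \<omega>)"

lemma square_integrable_inner_mult:
  assumes X: "square_integrable M X" and Y: "square_integrable M Y"
  shows "integrable M (\<lambda>\<omega>. (a \<bullet> X \<omega>) * (b \<bullet> Y \<omega>))"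
proof (rule Bochner_Integration.integrable_bound)
  have [measurable]: "X \<in> borel_measurable M" "Y \<in> borel_measurable M"
    using X Y by (auto simp: square_integrable_def)
  show "integrable M (\<lambda>\<omega>. (norm a * norm b) * (X \<omega> \<bullet> X \<omega> + Y \<omega> \<bullet> Y \<omega>))"
    using X Y by (simp add: square_integrable_def)
  show "(\<lambda>\<omega>. (a \<bullet> X \<omega>) * (b \<bullet> Y \<omega>)) \<in> borel_measurable M" by measurable
  have "\<bar>(a \<bullet> x) * (b \<bullet> y)\<bar> \<le> (norm a * norm b) * (x \<bullet> x + y \<bullet> y)" for x y
  proof -
    have "\<bar>(a \<bullet> x) * (b \<bullet> y)\<bar> \<le> (norm a * norm x) * (norm b * norm y)"
      unfolding abs_mult by (intro mult_mono Cauchy_Schwarz_ineq2) auto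
    also have "\<dots> = (norm a * norm b) * (norm x * norm y)" by simp
    also have "\<dots> \<le> (norm a * norm b) * ((norm x)\<^sup>2 + (norm y)\<^sup>2)"
    proof (rule mult_left_mono)
      have "0 \<le> (norm x - norm y)\<^sup>2" "0 \<le> norm x * norm y" by auto
      then show "norm x * norm y \<le> (norm x)\<^sup>2 + (norm y)\<^sup>2" by (simp only: power2_diff)
    qed simp
    finally show ?thesis by (simp add: power2_norm_eq_inner)
  qed
  then show "AE \<omega> in M. norm ((a \<bullet> X \<omega>) * (b \<bullet> Y \<omega>))
      \<le> norm ((norm a * norm b) * (X \<omega> \<bullet> X \<omega> + Y \<omega> \<bullet> Y \<omega>))" by simp
qed

lemma (in prob_space) square_integrable_imp_integrable:
  assumes X: "square_integrable M X"
  shows "integrable M X"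
proof (rule Bochner_Integration.integrable_bound)
  show "integrable M (\<lambda>\<omega>. 1 + X \<omega> \<bullet> X \<omega>)" "X \<in> borel_measurable M"
    using X by (auto simp: square_integrable_def)
  have "norm x \<le> 1 + x \<bullet> x" for x :: "real^'b"
  proof -
    have "0 \<le> (norm x - 1)\<^sup>2" by simp
    then have "2 * norm x \<le> x \<bullet> x + 1" by (simp add: power2_diff power2_norm_eq_inner)
    then show ?thesis using norm_ge_zero[of x] by linarith
  qed
  then show "AE \<omega> in M. norm (X \<omega>) \<le> norm (1 + X \<omega> \<bullet> X \<omega>)" by simp
qed

lemma square_integrable_affine:
  assumes X: "square_integrable M X" and W: "square_integrable M W"
  shows "square_integrable M (\<lambda>\<omega>. F *v X \<omega> + W \<omega>)"
proof -
  have [measurable]: "X \<in> borel_measurable M" "W \<in> borel_measurable M"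
    using X W by (auto simp: square_integrable_def)
  have FX: "(\<lambda>\<omega>. F *v X \<omega>) \<in> borel_measurable M"
    by (rule borel_measurable_continuous_on[OF _ \<open>X \<in> _\<close>])
      (intro linear_continuous_on matrix_vector_mul_bounded_linear)
  obtain k where k: "0 < k" "\<And>x. (F *v x) \<bullet> (F *v x) \<le> k * (x \<bullet> x)"
    using matrix_vector_norm_bound[of F] by blast
  have "integrable M (\<lambda>\<omega>. (F *v X \<omega> + W \<omega>) \<bullet> (F *v X \<omega> + W \<omega>))"
  proof (rule Bochner_Integration.integrable_bound)
    show "integrable M (\<lambda>\<omega>. 2 * (k * (X \<omega> \<bullet> X \<omega>)) + 2 * (W \<omega> \<bullet> W \<omega>))"
      using X W by (simp add: square_integrable_def)
    show "(\<lambda>\<omega>. (F *v X \<omega> + W \<omega>) \<bullet> (F *v X \<omega> + W \<omega>)) \<in> borel_measurable M"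
      using FX by measurable
    have "(y + z) \<bullet> (y + z) \<le> 2 * (y \<bullet> y) + 2 * (z \<bullet> z)" for y z :: "real^'c"
      using inner_ge_zero[of "y - z"] by (simp add: inner_add inner_diff inner_commute)
    then have "(F *v X \<omega> + W \<omega>) \<bullet> (F *v X \<omega> + W \<omega>) \<le> 2 * (k * (X \<omega> \<bullet> X \<omega>)) + 2 * (W \<omega> \<bullet> W \<omega>)" for \<omega>
      using k(2)[of "X \<omega>"] by (smt (verit))
    moreover have "0 \<le> 2 * (k * (X \<omega> \<bullet> X \<omega>)) + 2 * (W \<omega> \<bullet> W \<omega>)" for \<omega> using k(1) by simp
    ultimately show "AE \<omega> in M. norm ((F *v X \<omega> + W \<omega>) \<bullet> (F *v X \<omega> + W \<omega>))
        \<le> norm (2 * (k * (X \<omega> \<bullet> X \<omega>)) + 2 * (W \<omega> \<bullet> W \<omega>))" by (simp add: abs_of_nonneg)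
  qed
  then show ?thesis using FX by (simp add: square_integrable_def)
qed

lemma (in prob_space) gaussian_square_integrable:
  fixes X :: "'a \<Rightarrow> real^'n"
  assumes G: "gaussian M X \<mu> C"
  shows "square_integrable M X"
proof -
  have "integrable M (\<lambda>\<omega>. \<Sum>i\<in>UNIV. (axis i 1 \<bullet> X \<omega>)\<^sup>2)"
    by (intro Bochner_Integration.integrable_sum gaussian_inner_moments[OF G])
  then have "integrable M (\<lambda>\<omega>. X \<omega> \<bullet> X \<omega>)"
    by (simp add: inner_vec_def[of "X _"] inner_axis' power2_eq_square)
  then show ?thesis using G by (simp add: square_integrable_def gaussian_def)
qed

text \<open>Polarization: \<open>gaussian\<close> prescribes the law of one linear functional at a
  time, so the product of two is recovered from the functional given by
  \<open>a + b\<close>.\<close>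

lemma (in prob_space) gaussian_mixed_moment:
  assumes G: "gaussian M X \<mu> C"
  shows "expectation (\<lambda>\<omega>. (a \<bullet> X \<omega>) * (b \<bullet> X \<omega>)) = a \<bullet> ((C + outer \<mu> \<mu>) *v b)"
proof -
  note sq = gaussian_square_integrable[OF G]
  note prod = square_integrable_inner_mult[OF sq sq]
  have C: "transpose C = C" using G by (simp add: gaussian_def psd_mats_def)
  have "expectation (\<lambda>\<omega>. ((a + b) \<bullet> X \<omega>)\<^sup>2)
     = expectation (\<lambda>\<omega>. (a \<bullet> X \<omega>)\<^sup>2 + 2 * ((a \<bullet> X \<omega>) * (b \<bullet> X \<omega>)) + (b \<bullet> X \<omega>)\<^sup>2)"
    by (intro Bochner_Integration.integral_cong)
      (simp_all add: inner_add_left power2_eq_square algebra_simps)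
  also have "\<dots> = expectation (\<lambda>\<omega>. (a \<bullet> X \<omega>)\<^sup>2) + 2 * expectation (\<lambda>\<omega>. (a \<bullet> X \<omega>) * (b \<bullet> X \<omega>))
     + expectation (\<lambda>\<omega>. (b \<bullet> X \<omega>)\<^sup>2)"
    using prod gaussian_inner_moments(1)[OF G] by simp
  finally have "2 * expectation (\<lambda>\<omega>. (a \<bullet> X \<omega>) * (b \<bullet> X \<omega>))
     = (a + b) \<bullet> (C *v (a + b)) + ((a + b) \<bullet> \<mu>)\<^sup>2
       - (a \<bullet> (C *v a) + (a \<bullet> \<mu>)\<^sup>2) - (b \<bullet> (C *v b) + (b \<bullet> \<mu>)\<^sup>2)"
    unfolding gaussian_inner_moments(3)[OF G] by simp
  also have "\<dots> = 2 * (a \<bullet> (C *v b) + (a \<bullet> \<mu>) * (b \<bullet> \<mu>))"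
    using psd_symmetric[OF C, of b a]
    by (simp add: matrix_vector_right_distrib inner_add power2_sum)
  finally show ?thesis
    by (simp add: matrix_vector_mult_add_rdistrib outer_mult_vec inner_add_right inner_commute
        mult.commute)
qed

text \<open>Both scalar variables are measurable for the generated sigma-algebras, and independence
  passes to smaller families of events.\<close>

lemma (in prob_space) indep_of_noise_inner:
  fixes x0 :: "'a \<Rightarrow> real^'n"
  assumes ind: "indep_of_noise M x0 w" and x0: "x0 \<in> borel_measurable M"
    and w: "\<And>k. w k \<in> borel_measurable M"
  shows "indep_var borel (\<lambda>\<omega>. a \<bullet> x0 \<omega>) borel (\<lambda>\<omega>. b \<bullet> w j \<omega>)"
proof -
  let ?V1 = "vimage_algebra (space M) x0 borel"
  let ?V2 = "vimage_algebra (space M) (\<lambda>\<omega> k. w k \<omega>) (\<Pi>\<^sub>M k\<in>(UNIV::nat set). borel)"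
  have sub: "sigma_sets (space M) {f -` S \<inter> space M |S. S \<in> sets borel} \<subseteq> sets V"
    if "f \<in> borel_measurable V" "space V = space M" for f :: "'a \<Rightarrow> real" and V
    unfolding that(2)[symmetric] using that(1)
    by (intro sets.sigma_sets_subset) (auto intro: measurable_sets)
  have "x0 \<in> ?V1 \<rightarrow>\<^sub>M borel" by (rule measurable_vimage_algebra1) auto
  then have "(\<lambda>\<omega>. a \<bullet> x0 \<omega>) \<in> borel_measurable ?V1" by measurable
  then have 1: "sigma_sets (space M) {(\<lambda>\<omega>. a \<bullet> x0 \<omega>) -` S \<inter> space M |S. S \<in> sets borel} \<subseteq> sets ?V1"
    by (rule sub) simp
  have "(\<lambda>\<omega> k. w k \<omega>) \<in> ?V2 \<rightarrow>\<^sub>M (\<Pi>\<^sub>M k\<in>UNIV. borel)"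
    by (rule measurable_vimage_algebra1) (auto simp: space_PiM)
  then have "(\<lambda>\<omega>. (\<lambda>k. w k \<omega>) j) \<in> ?V2 \<rightarrow>\<^sub>M borel"
    by (rule measurable_compose[OF _ measurable_component_singleton]) simp
  then have "(\<lambda>\<omega>. b \<bullet> w j \<omega>) \<in> borel_measurable ?V2" by measurable
  then have 2: "sigma_sets (space M) {(\<lambda>\<omega>. b \<bullet> w j \<omega>) -` S \<inter> space M |S. S \<in> sets borel} \<subseteq> sets ?V2"
    by (rule sub) simp
  have "indep_set (sigma_sets (space M) {(\<lambda>\<omega>. a \<bullet> x0 \<omega>) -` S \<inter> space M |S. S \<in> sets borel})
     (sigma_sets (space M) {(\<lambda>\<omega>. b \<bullet> w j \<omega>) -` S \<inter> space M |S. S \<in> sets borel})"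
    using ind unfolding indep_of_noise_def indep_set_def
    by (rule indep_sets_mono_sets) (use 1 2 in \<open>auto split: bool.split\<close>)
  moreover have "(\<lambda>\<omega>. a \<bullet> x0 \<omega>) \<in> borel_measurable M" "(\<lambda>\<omega>. b \<bullet> w j \<omega>) \<in> borel_measurable M"
    using x0 w[of j] by measurable
  ultimately show ?thesis by (simp add: indep_var_eq)
qed

lemma (in prob_space) indep_vars_inner:
  fixes w :: "nat \<Rightarrow> 'a \<Rightarrow> real^'n"
  assumes ind: "indep_vars (\<lambda>_. borel) w UNIV" and ij: "i \<noteq> j"
  shows "indep_var borel (\<lambda>\<omega>. a \<bullet> w i \<omega>) borel (\<lambda>\<omega>. b \<bullet> w j \<omega>)"
proof -
  \<comment> \<open>One family carrying both test vectors; a sum over the singleton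
    \<open>{j}\<close> then extracts the pair from it.\<close>
  let ?X = "\<lambda>k \<omega>. (if k = i then a else b) \<bullet> w k \<omega>"
  have "indep_vars (\<lambda>_. borel) ?X (insert i {j})"
    by (rule indep_vars_compose2[OF indep_vars_subset[OF ind]]) auto
  then have "indep_var borel (?X i) borel (\<lambda>\<omega>. \<Sum>k\<in>{j}. ?X k \<omega>)"
    using ij by (intro indep_vars_sum) auto
  then show ?thesis using ij by simp
qed

section \<open>Second moment matrices as integrals\<close>

lemma norm_outer_le: "norm (outer x x) \<le> real CARD('n) * real CARD('n) * (x \<bullet> x)"
  for x :: "real^'n"
proof -
  have "\<bar>x $ i * x $ j\<bar> \<le> x \<bullet> x" for i j
  proof -
    have "\<bar>x $ i * x $ j\<bar> \<le> norm x * norm x"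
      unfolding abs_mult by (intro mult_mono component_le_norm_cart) auto
    then show ?thesis by (simp add: power2_norm_eq_inner[symmetric] power2_eq_square)
  qed
  then have "norm (outer x x $ i) \<le> (\<Sum>j\<in>(UNIV::'n set). x \<bullet> x)" for i
    by (intro order_trans[OF norm_le_l1_cart] sum_mono) (simp add: outer_def)
  then have "norm (outer x x) \<le> (\<Sum>i\<in>(UNIV::'n set). \<Sum>j\<in>(UNIV::'n set). x \<bullet> x)"
    unfolding norm_vec_def[of "outer x x"] by (intro order_trans[OF L2_set_le_sum] sum_mono) auto
  then show ?thesis by simp
qed

lemma square_integrable_outer:
  fixes X :: "'a \<Rightarrow> real^'n"
  assumes X: "square_integrable M X"
  shows "integrable M (\<lambda>\<omega>. outer (X \<omega>) (X \<omega>))"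
proof (rule Bochner_Integration.integrable_bound)
  show "integrable M (\<lambda>\<omega>. real CARD('n) * real CARD('n) * (X \<omega> \<bullet> X \<omega>))"
    using X by (simp add: square_integrable_def)
  have "continuous_on UNIV (\<lambda>x::real^'n. outer x x)"
    unfolding outer_def by (intro continuous_intros)
  then show "(\<lambda>\<omega>. outer (X \<omega>) (X \<omega>)) \<in> borel_measurable M"
    using X by (intro borel_measurable_continuous_on[of "\<lambda>x. outer x x"])
      (auto simp: square_integrable_def)
  show "AE \<omega> in M. norm (outer (X \<omega>) (X \<omega>))
      \<le> norm (real CARD('n) * real CARD('n) * (X \<omega> \<bullet> X \<omega>))"
    using norm_outer_le by (intro AE_I2 order_trans[OF norm_outer_le]) simp
qed

text \<open>Evaluating a matrix on two vectors is a bounded linear functional, so it passes through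
  the matrix-valued integral.\<close>

lemma integral_inner_outer:
  fixes X :: "'a \<Rightarrow> real^'n"
  assumes X: "square_integrable M X"
  shows "a \<bullet> ((\<integral>\<omega>. outer (X \<omega>) (X \<omega>) \<partial>M) *v b) = (\<integral>\<omega>. (a \<bullet> X \<omega>) * (b \<bullet> X \<omega>) \<partial>M)"
proof -
  have "linear (\<lambda>Z::real^'n^'n. a \<bullet> (Z *v b))"
    by (rule linearI)
      (simp_all add: matrix_vector_mult_add_rdistrib inner_add_right scaleR_matrix_vector_assoc[symmetric])
  then have "bounded_linear (\<lambda>Z::real^'n^'n. a \<bullet> (Z *v b))" by (simp add: linear_conv_bounded_linear)
  from integral_bounded_linear[OF this square_integrable_outer[OF X]]
  show ?thesis by (simp add: outer_mult_vec mult.commute inner_commute)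
qed

lemma integral_quadratic:
  fixes X :: "'a \<Rightarrow> real^'n"
  assumes X: "square_integrable M X"
  shows "(\<integral>\<omega>. X \<omega> \<bullet> (N *v X \<omega>) \<partial>M) = trace (N ** (\<integral>\<omega>. outer (X \<omega>) (X \<omega>) \<partial>M))"
proof -
  have "linear (\<lambda>Z::real^'n^'n. trace (N ** Z))"
    by (rule linearI) (simp_all add: trace_mult_add trace_mult_scaleR)
  then have "bounded_linear (\<lambda>Z::real^'n^'n. trace (N ** Z))" by (simp add: linear_conv_bounded_linear)
  from integral_bounded_linear[OF this square_integrable_outer[OF X]]
  show ?thesis by (simp add: trace_mult_outer)
qed

lemma gaussian_second_moment:
  assumes "prob_space M" and G: "gaussian M X \<mu> C"
  shows "(\<integral>\<omega>. outer (X \<omega>) (X \<omega>) \<partial>M) = C + outer \<mu> \<mu>"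
proof -
  interpret prob_space M by fact
  show ?thesis
    by (simp add: matrix_eq_bilinear integral_inner_outer[OF gaussian_square_integrable[OF G]]
        gaussian_mixed_moment[OF G])
qed

lemma state_square_integrable:
  assumes "prob_space M" and G: "gaussian M x0 \<mu>0 C0" and W: "gaussian_noise M w C"
  shows "square_integrable M (state F x0 w k)"
proof -
  interpret prob_space M by fact
  show ?thesis
  proof (induction k)
    case 0 show ?case using gaussian_square_integrable[OF G] by simp
  next
    case (Suc k)
    have "square_integrable M (w k)"
      using W by (auto simp: gaussian_noise_def intro: gaussian_square_integrable)
    with Suc show ?case by (simp add: square_integrable_affine)
  qed
qed

lemma state_mean_recursion:
  assumes M: "prob_space M" and G: "gaussian M x0 \<mu>0 C0" and W: "gaussian_noise M w C"
  shows "(\<integral>\<omega>. state F x0 w (Suc k) \<omega> \<partial>M) = F *v (\<integral>\<omega>. state F x0 w k \<omega> \<partial>M)"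
proof -
  interpret prob_space M by (rule M)
  have wk: "gaussian M (w k) 0 C" using W by (simp add: gaussian_noise_def)
  have x: "integrable M (state F x0 w k)"
    by (intro square_integrable_imp_integrable state_square_integrable[OF M G W])
  have w: "integrable M (w k)"
    by (intro square_integrable_imp_integrable gaussian_square_integrable[OF wk])
  have "b \<bullet> expectation (w k) = 0" for b
    using integral_bounded_linear[OF bounded_linear_inner_right w, of b] gaussian_inner_moments(2)[OF wk, of b]
    by simp
  then have "expectation (w k) = 0" by (metis inner_eq_zero_iff)
  moreover have "integrable M (\<lambda>\<omega>. F *v state F x0 w k \<omega>)"
    by (rule integrable_bounded_linear[OF matrix_vector_mul_bounded_linear x])
  ultimately show ?thesis
    using w integral_bounded_linear[OF matrix_vector_mul_bounded_linear x, of F] by simp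
qed

text \<open>Unwinding the state leaves the initial state and earlier noise, each independent of the
  centred \<open>w j\<close>. The test vector varies in the induction because each step moves
  \<open>F\<close> onto it.\<close>

lemma (in prob_space) noise_uncorrelated:
  fixes x0 :: "'a \<Rightarrow> real^'n"
  assumes G: "gaussian M x0 \<mu>0 C0" and W: "gaussian_noise M w C" and ind: "indep_of_noise M x0 w"
    and "k \<le> j"
  shows "expectation (\<lambda>\<omega>. (a \<bullet> state F x0 w k \<omega>) * (b \<bullet> w j \<omega>)) = 0"
  using \<open>k \<le> j\<close>
proof (induction k arbitrary: a)
  have wG: "gaussian M (w i) 0 C" for i using W by (simp add: gaussian_noise_def)
  have wS: "square_integrable M (w i)" for i by (rule gaussian_square_integrable[OF wG])
  have int: "integrable M (\<lambda>\<omega>. c \<bullet> X \<omega>)" if "square_integrable M X" for c and X :: "'a \<Rightarrow> real^'n"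
    using integrable_bounded_linear[OF bounded_linear_inner_right square_integrable_imp_integrable[OF that]] .
  have w0: "expectation (\<lambda>\<omega>. b \<bullet> w j \<omega>) = 0" using gaussian_inner_moments(2)[OF wG] by simp
  {
    case 0
    have "indep_var borel (\<lambda>\<omega>. a \<bullet> x0 \<omega>) borel (\<lambda>\<omega>. b \<bullet> w j \<omega>)"
      using ind by (rule indep_of_noise_inner) (use G wG in \<open>auto simp: gaussian_def\<close>)
    then have "expectation (\<lambda>\<omega>. (a \<bullet> x0 \<omega>) * (b \<bullet> w j \<omega>))
        = expectation (\<lambda>\<omega>. a \<bullet> x0 \<omega>) * expectation (\<lambda>\<omega>. b \<bullet> w j \<omega>)"
      by (rule indep_var_lebesgue_integral) (intro int wS gaussian_square_integrable[OF G])+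
    then show ?case using w0 by simp
  next
    case (Suc k)
    have "indep_var borel (\<lambda>\<omega>. a \<bullet> w k \<omega>) borel (\<lambda>\<omega>. b \<bullet> w j \<omega>)"
      using W Suc.prems by (intro indep_vars_inner) (auto simp: gaussian_noise_def)
    then have ww: "expectation (\<lambda>\<omega>. (a \<bullet> w k \<omega>) * (b \<bullet> w j \<omega>)) = 0"
      using w0 by (subst indep_var_lebesgue_integral) (auto intro: int wS)
    have xS: "square_integrable M (state F x0 w k)"
      by (rule state_square_integrable[OF prob_space_axioms G W])
    have "expectation (\<lambda>\<omega>. (a \<bullet> state F x0 w (Suc k) \<omega>) * (b \<bullet> w j \<omega>))
       = expectation (\<lambda>\<omega>. ((transpose F *v a) \<bullet> state F x0 w k \<omega>) * (b \<bullet> w j \<omega>)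
          + (a \<bullet> w k \<omega>) * (b \<bullet> w j \<omega>))"
      by (simp add: inner_matrix_transpose_left inner_add_right distrib_right)
    also have "\<dots> = expectation (\<lambda>\<omega>. ((transpose F *v a) \<bullet> state F x0 w k \<omega>) * (b \<bullet> w j \<omega>))
       + expectation (\<lambda>\<omega>. (a \<bullet> w k \<omega>) * (b \<bullet> w j \<omega>))"
      by (intro Bochner_Integration.integral_add square_integrable_inner_mult xS wS)
    finally show ?case using Suc ww by simp
  }
qed

text \<open>The product of the two tested states expands into four expectations; the mixed ones
  vanish by \<open>noise_uncorrelated\<close>.\<close>

lemma state_second_moment_recursion:
  fixes x0 :: "'a \<Rightarrow> real^'n" and F :: "real^'n^'n"
  assumes M: "prob_space M" and G: "gaussian M x0 \<mu>0 C0" and W: "gaussian_noise M w C"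
    and ind: "indep_of_noise M x0 w"
  defines "X \<equiv> \<lambda>k. \<integral>\<omega>. outer (state F x0 w k \<omega>) (state F x0 w k \<omega>) \<partial>M"
  shows "X (Suc k) = F ** X k ** transpose F + C"
proof -
  interpret prob_space M by (rule M)
  have wG: "gaussian M (w k) 0 C" using W by (simp add: gaussian_noise_def)
  have wS: "square_integrable M (w k)" by (rule gaussian_square_integrable[OF wG])
  note xS = state_square_integrable[OF M G W, of F]
  let ?x = "state F x0 w k" and ?T = "transpose F"
  have "a \<bullet> (X (Suc k) *v b) = a \<bullet> ((F ** X k ** transpose F + C) *v b)" for a b
  proof -
    have "a \<bullet> (X (Suc k) *v b)
        = expectation (\<lambda>\<omega>. (a \<bullet> state F x0 w (Suc k) \<omega>) * (b \<bullet> state F x0 w (Suc k) \<omega>))"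
      unfolding X_def by (rule integral_inner_outer[OF xS])
    also have "\<dots> = expectation (\<lambda>\<omega>. ((?T *v a) \<bullet> ?x \<omega>) * ((?T *v b) \<bullet> ?x \<omega>)
        + ((?T *v a) \<bullet> ?x \<omega>) * (b \<bullet> w k \<omega>) + ((?T *v b) \<bullet> ?x \<omega>) * (a \<bullet> w k \<omega>)
        + (a \<bullet> w k \<omega>) * (b \<bullet> w k \<omega>))"
      by (simp add: inner_matrix_transpose_left inner_add_right algebra_simps)
    also have "\<dots> = expectation (\<lambda>\<omega>. ((?T *v a) \<bullet> ?x \<omega>) * ((?T *v b) \<bullet> ?x \<omega>))
        + expectation (\<lambda>\<omega>. ((?T *v a) \<bullet> ?x \<omega>) * (b \<bullet> w k \<omega>))
        + expectation (\<lambda>\<omega>. ((?T *v b) \<bullet> ?x \<omega>) * (a \<bullet> w k \<omega>))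
        + expectation (\<lambda>\<omega>. (a \<bullet> w k \<omega>) * (b \<bullet> w k \<omega>))"
      using square_integrable_inner_mult[OF xS xS] square_integrable_inner_mult[OF xS wS]
        square_integrable_inner_mult[OF wS wS] by simp
    also have "\<dots> = (?T *v a) \<bullet> (X k *v (?T *v b)) + a \<bullet> (C *v b)"
      using noise_uncorrelated[OF G W ind, of k k] gaussian_mixed_moment[OF wG, of a b]
      by (simp add: X_def integral_inner_outer[OF xS] matrix_vector_mult_add_rdistrib inner_add_right
          outer_mult_vec)
    finally show ?thesis
      by (simp add: matrix_vector_mult_add_rdistrib inner_add_right inner_congruence_transpose)
  qed
  then show ?thesis by (simp add: matrix_eq_bilinear)
qed

text \<open>Each expected stage cost is a trace against the second moment matrix, so
  \<open>discounted_moment_sums\<close> evaluates the series; its initial matrix is the second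
  moment of \<open>x0\<close>.\<close>

lemma slq_cost_eq_trace:
  fixes A :: "real^'n^'n" and B :: "real^'m^'n"
  assumes M: "prob_space M" and G: "gaussian M x0 \<mu>0 \<Sigma>0" and W: "gaussian_noise M w \<Sigma>"
    and ind: "indep_of_noise M x0 w"
    and F: "power_stable (A + B ** L)" and r: "0 < r" "r < 1"
    and Y: "Y = r *\<^sub>R ((A + B ** L) ** Y ** transpose (A + B ** L))
       + (\<Sigma>0 + outer \<mu>0 \<mu>0 + (r / (1 - r)) *\<^sub>R \<Sigma>)"
  shows "slq_cost M A B (block_diag Q R) r x0 w L = trace (stage_cost Q R L ** Y)"
proof -
  let ?x = "state (A + B ** L) x0 w"
  define X where "X = (\<lambda>k. \<integral>\<omega>. outer (?x k \<omega>) (?x k \<omega>) \<partial>M)"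
  have "(let x = ?x k \<omega>; z = vec_append x (L *v x) in z \<bullet> (block_diag Q R *v z))
      = ?x k \<omega> \<bullet> (stage_cost Q R L *v ?x k \<omega>)" for k \<omega>
    by (simp add: Let_def block_diag_mult_vec inner_vec_append inner_stage_cost)
  then have "slq_cost M A B (block_diag Q R) r x0 w L = (\<Sum>k. r ^ k * trace (stage_cost Q R L ** X k))"
    by (simp add: slq_cost_def X_def integral_quadratic[OF state_square_integrable[OF M G W]])
  also have "\<dots> = trace (stage_cost Q R L ** Y)"
  proof (rule sums_unique[symmetric], rule discounted_moment_sums[OF F r])
    show "X (Suc k) = (A + B ** L) ** X k ** transpose (A + B ** L) + \<Sigma>" for k
      unfolding X_def by (rule state_second_moment_recursion[OF M G W ind])
    show "Y = r *\<^sub>R ((A + B ** L) ** Y ** transpose (A + B ** L)) + (X 0 + (r / (1 - r)) *\<^sub>R \<Sigma>)"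
      using Y gaussian_second_moment[OF M G] by (simp add: X_def)
  qed
  finally show ?thesis .
qed

section \<open>Mean square stability\<close>

lemma power_stable_imp_mean_square_stable:
  fixes F :: "real^'n^'n"
  assumes F: "power_stable F"
  shows "mean_square_stable F"
  unfolding mean_square_stable_def
proof (intro allI impI, elim conjE)
  fix M :: "(nat \<Rightarrow> real^'n) measure" and w and C :: "real^'n^'n"
  assume M: "prob_space M" and W: "gaussian_noise M w C"
  \<comment> \<open>The limit is fixed before any initial state, matching the order of
    quantifiers.\<close>
  obtain Xl where Xl: "\<And>X. (\<And>k. X (Suc k) = F ** X k ** transpose F + C) \<Longrightarrow> X \<longlonglongrightarrow> Xl"
    using moment_recursion_tendsto[OF F, of C] by blast
  show "\<exists>\<mu> X. \<forall>x0 \<mu>0 C0. gaussian M x0 \<mu>0 C0 \<and> C0 \<in> pd_mats \<and> indep_of_noise M x0 w \<longrightarrow>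
      (\<lambda>k. \<integral>\<omega>. state F x0 w k \<omega> \<partial>M) \<longlonglongrightarrow> \<mu> \<and>
      (\<lambda>k. \<integral>\<omega>. outer (state F x0 w k \<omega>) (state F x0 w k \<omega>) \<partial>M) \<longlonglongrightarrow> X"
  proof (intro exI allI impI conjI, elim conjE)
    fix x0 \<mu>0 C0
    assume G: "gaussian M x0 \<mu>0 C0" and ind: "indep_of_noise M x0 w"
    have "(\<integral>\<omega>. state F x0 w k \<omega> \<partial>M) = ((*v) F ^^ k) (\<integral>\<omega>. x0 \<omega> \<partial>M)" for k
    proof (induction k)
      case (Suc k)
      then show ?case using state_mean_recursion[OF M G W, of F k] by simp
    qed simp
    then show "(\<lambda>k. \<integral>\<omega>. state F x0 w k \<omega> \<partial>M) \<longlonglongrightarrow> 0"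
      using F by (simp add: power_stable_def)
  next
    fix x0 \<mu>0 C0
    assume "gaussian M x0 \<mu>0 C0 \<and> C0 \<in> pd_mats \<and> indep_of_noise M x0 w"
    then show "(\<lambda>k. \<integral>\<omega>. outer (state F x0 w k \<omega>) (state F x0 w k \<omega>) \<partial>M) \<longlonglongrightarrow> Xl"
      using state_second_moment_recursion[OF M _ W] by (intro Xl) blast
  qed
qed

section \<open>A Gaussian vector on the space of sequences\<close>

lemma indep_vars_PiM_coordinates:
  assumes "\<And>i. prob_space (N i)" and I: "I \<noteq> {}"
  shows "prob_space.indep_vars (PiM I N) N (\<lambda>i f. f i) I"
proof -
  have P: "prob_space (PiM I N)" using assms(1) by (intro prob_space_PiM)
  have "distr (PiM I N) (PiM I N) (\<lambda>x. \<lambda>i\<in>I. x i) = PiM I N"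
  proof -
    have "distr (PiM I N) (PiM I N) (\<lambda>x. \<lambda>i\<in>I. x i) = distr (PiM I N) (PiM I N) (\<lambda>x. x)"
      by (rule distr_cong) (auto simp: space_PiM)
    then show ?thesis by (simp add: distr_id2)
  qed
  moreover have "PiM I (\<lambda>i. distr (PiM I N) (N i) (\<lambda>f. f i)) = PiM I N"
    using assms(1) by (intro PiM_cong) (auto simp: distr_PiM_component)
  ultimately show ?thesis
    by (subst prob_space.indep_vars_iff_distr_eq_PiM'[OF P I]) auto
qed

text \<open>Mean square stability says something only if Gaussian initial states exist on the
  sequence space. Independent normal coordinates are built on a product space and carried over as
  constant sequences; translating a single \<open>Z\<close> gives every mean.\<close>

lemma standard_gaussian_exists:
  obtains M :: "(nat \<Rightarrow> real^'n) measure" and Z :: "(nat \<Rightarrow> real^'n) \<Rightarrow> real^'n"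
  where "prob_space M" "\<And>\<mu>. gaussian M (\<lambda>\<omega>. \<mu> + Z \<omega>) \<mu> (mat 1)"
proof -
  define D where "D = density lborel (\<lambda>x. ennreal (std_normal_density x))"
  define N where "N = PiM (UNIV :: 'n set) (\<lambda>_. D)"
  have D: "prob_space D" unfolding D_def by (rule prob_space_normal_density) simp
  have D_borel [measurable_cong]: "sets D = sets borel" by (simp add: D_def)
  interpret N: prob_space N unfolding N_def using D by (intro prob_space_PiM)
  have coord [measurable]: "(\<lambda>f. f i) \<in> borel_measurable N" for i
  proof -
    have "(\<lambda>f. f i) \<in> N \<rightarrow>\<^sub>M D" unfolding N_def by measurable
    then show ?thesis by (simp add: measurable_cong_sets[OF refl D_borel])
  qed
  have "N.indep_vars (\<lambda>_. D) (\<lambda>i f. f i) UNIV"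
    unfolding N_def using D by (intro indep_vars_PiM_coordinates) auto
  then have indep: "N.indep_vars (\<lambda>_. borel) (\<lambda>i f. f i) UNIV"
    by (rule N.indep_vars_compose2) (auto simp: measurable_cong_sets[OF D_borel refl])
  have distr: "distributed N lborel (\<lambda>f. f i) (\<lambda>x. ennreal (std_normal_density x))" for i
  proof -
    have "distr N lborel (\<lambda>f. f i) = distr N D (\<lambda>f. f i)"
      by (rule distr_cong) (auto simp: D_borel)
    also have "\<dots> = D" unfolding N_def using D by (intro distr_PiM_component) auto
    finally show ?thesis by (simp add: distributed_def D_def[symmetric])
  qed
  define vec :: "('n \<Rightarrow> real) \<Rightarrow> real^'n" where "vec = (\<lambda>f. \<chi> i. f i)"
  have vec [measurable]: "vec \<in> borel_measurable N"
    by (subst borel_measurable_euclidean_space) (auto simp: vec_def Basis_vec_def inner_axis)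
  define emb :: "('n \<Rightarrow> real) \<Rightarrow> nat \<Rightarrow> real^'n" where "emb = (\<lambda>f _. vec f)"
  \<comment> \<open>Events depend on the entry at index 0 alone, so measurability of the embedding
    reduces to that of \<open>vec\<close>.\<close>
  define V :: "(nat \<Rightarrow> real^'n) measure" where "V = vimage_algebra UNIV (\<lambda>\<omega>. \<omega> 0) borel"
  have emb: "emb \<in> N \<rightarrow>\<^sub>M V"
    unfolding V_def emb_def by (rule measurable_vimage_algebra2) (use vec in auto)
  have Z: "(\<lambda>\<omega>. \<omega> 0) \<in> V \<rightarrow>\<^sub>M borel"
    unfolding V_def by (rule measurable_vimage_algebra1) auto
  show ?thesis
  proof (rule that)
    show "prob_space (distr N V emb)" using emb by (rule N.prob_space_distr)
    fix \<mu> :: "real^'n"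
    show "gaussian (distr N V emb) (\<lambda>\<omega>. \<mu> + \<omega> 0) \<mu> (mat 1)"
      unfolding gaussian_def
    proof (intro conjI allI)
      have X: "(\<lambda>\<omega>. \<mu> + \<omega> 0) \<in> borel_measurable V" using Z by measurable
      then show "(\<lambda>\<omega>. \<mu> + \<omega> 0) \<in> borel_measurable (distr N V emb)" by simp
      show "(mat 1 :: real^'n^'n) \<in> psd_mats" by (simp add: psd_mats_def)
      fix t :: "real^'n"
      have tX: "(\<lambda>\<omega>. t \<bullet> (\<mu> + \<omega> 0)) \<in> borel_measurable V" using X by measurable
      have "distributed (distr N V emb) lborel (\<lambda>\<omega>. t \<bullet> (\<mu> + \<omega> 0))
          (\<lambda>y. ennreal (normal_density (t \<bullet> \<mu>) (sqrt (t \<bullet> t)) y))" if t: "t \<noteq> 0"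
      proof -
        \<comment> \<open>Coordinates of weight zero are dropped, since a constant has no normal
          density.\<close>
        let ?I = "{i. t $ i \<noteq> 0}"
        have I: "?I \<noteq> {}" using t by (auto simp: vec_eq_iff)
        have "distributed N lborel (\<lambda>f. 0 + t $ i * f i)
            (\<lambda>x. ennreal (normal_density (0 + t $ i * 0) (\<bar>t $ i\<bar> * 1) x))" if "i \<in> ?I" for i
          using that by (intro N.normal_density_affine distr) auto
        moreover have "N.indep_vars (\<lambda>_. borel) (\<lambda>i f. t $ i * f i) ?I"
          by (rule N.indep_vars_compose2[OF N.indep_vars_subset[OF indep]]) auto
        ultimately have "distributed N lborel (\<lambda>f. \<Sum>i\<in>?I. t $ i * f i)
            (normal_density (\<Sum>i\<in>?I. 0) (sqrt (\<Sum>i\<in>?I. \<bar>t $ i\<bar>\<^sup>2)))"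
          using I by (intro N.sum_indep_normal) auto
        moreover have "(\<Sum>i\<in>?I. t $ i * f i) = t \<bullet> vec f" for f
          unfolding inner_vec_def vec_def by (auto intro!: sum.mono_neutral_left)
        moreover have "(\<Sum>i\<in>?I. \<bar>t $ i\<bar>\<^sup>2) = t \<bullet> t"
          unfolding inner_vec_def by (auto intro!: sum.mono_neutral_cong_left simp: power2_eq_square)
        ultimately have "distributed N lborel (\<lambda>f. t \<bullet> vec f) (normal_density 0 (sqrt (t \<bullet> t)))"
          by simp
        then have "distributed N lborel (\<lambda>f. t \<bullet> \<mu> + 1 * (t \<bullet> vec f))
            (normal_density (t \<bullet> \<mu> + 1 * 0) (\<bar>1\<bar> * sqrt (t \<bullet> t)))"
          by (rule N.normal_density_affine) (use t in auto)
        then have "distributed N lborel (\<lambda>f. t \<bullet> (\<mu> + emb f 0))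
            (normal_density (t \<bullet> \<mu>) (sqrt (t \<bullet> t)))"
          by (simp add: emb_def inner_add_right)
        then show ?thesis
          using tX emb by (simp add: distributed_def distr_distr comp_def)
      qed
      then show "if t \<bullet> (mat 1 *v t) = 0 then AE \<omega> in distr N V emb. t \<bullet> (\<mu> + \<omega> 0) = t \<bullet> \<mu>
          else distributed (distr N V emb) lborel (\<lambda>\<omega>. t \<bullet> (\<mu> + \<omega> 0))
             (\<lambda>y. ennreal (normal_density (t \<bullet> \<mu>) (sqrt (t \<bullet> (mat 1 *v t))) y))"
        by auto
    qed
  qed
qed

text \<open>Gaussian initial states of arbitrary mean, driven by zero noise, make the powers of \<open>F\<close>
  converge to a common limit on every vector, which is the limit \<open>0\<close> on the zero vector.\<close>

lemma mean_square_stable_imp_power_stable: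
  fixes F :: "real^'n^'n"
  assumes mss: "mean_square_stable F"
  shows "power_stable F"
proof -
  obtain M :: "(nat \<Rightarrow> real^'n) measure" and Z :: "(nat \<Rightarrow> real^'n) \<Rightarrow> real^'n"
    where M: "prob_space M" and Z: "\<And>\<mu>. gaussian M (\<lambda>\<omega>. \<mu> + Z \<omega>) \<mu> (mat 1)"
    using standard_gaussian_exists by blast
  interpret prob_space M by (rule M)
  let ?w = "\<lambda>(k::nat) (\<omega>::nat \<Rightarrow> real^'n). 0 :: real^'n"
  have "indep_vars (\<lambda>_. borel) ?w UNIV"
  proof -
    \<comment> \<open>A constant generates only trivial events, which are independent of each other
      and, further below, of any initial state.\<close>
    have trivial: "?w i -` A \<inter> space M \<in> {{}, space M}" for i A by auto
    have "indep_sets (\<lambda>_. {{}, space M}) (UNIV :: nat set)"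
    proof (rule indep_setsI)
      fix A :: "nat \<Rightarrow> (nat \<Rightarrow> real^'n) set" and J :: "nat set"
      assume J: "J \<noteq> {}" "finite J" "\<forall>j\<in>J. A j \<in> {{}, space M}"
      show "prob (\<Inter>j\<in>J. A j) = (\<Prod>j\<in>J. prob (A j))"
      proof (cases "\<exists>j\<in>J. A j = {}")
        case True
        then have "(\<Inter>j\<in>J. A j) = {}" by auto
        with True J(2) show ?thesis by (force simp: prod_zero_iff)
      next
        case False
        then have "\<And>j. j \<in> J \<Longrightarrow> A j = space M" using J(3) by auto
        with J(1) show ?thesis by (simp add: prob_space)
      qed
    qed auto
    then have "indep_sets (\<lambda>i. {?w i -` A \<inter> space M |A. A \<in> sets borel}) UNIV"
      by (rule indep_sets_mono_sets) (use trivial in blast)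
    then show ?thesis by (simp add: indep_vars_def2)
  qed
  moreover have "gaussian M (?w k) 0 0" for k
    by (simp add: gaussian_def psd_mats_def transpose_def vec_eq_iff)
  ultimately have W: "gaussian_noise M ?w 0" by (simp add: gaussian_noise_def)
  have ind: "indep_of_noise M x0 ?w" if x0: "x0 \<in> borel_measurable M" for x0 :: "_ \<Rightarrow> real^'n"
  proof -
    let ?V1 = "vimage_algebra (space M) x0 borel"
    let ?V2 = "vimage_algebra (space M) (\<lambda>\<omega> k. ?w k \<omega>) (\<Pi>\<^sub>M k\<in>UNIV. borel)"
    have V2: "sets ?V2 \<subseteq> {{}, space M}"
      by (subst sets_vimage_algebra2) (auto simp: space_PiM)
    have V1: "sets ?V1 \<subseteq> events"
      by (subst sets_vimage_algebra2) (use x0 in \<open>auto intro: measurable_sets\<close>)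
    show ?thesis
      unfolding indep_of_noise_def
    proof (subst indep_sets2_eq, intro conjI ballI)
      show "sets ?V1 \<subseteq> events" by (rule V1)
      show "sets ?V2 \<subseteq> events" using V2 by blast
      fix a b assume "a \<in> sets ?V1" "b \<in> sets ?V2"
      then have "a \<in> events" "b = {} \<or> b = space M" using V1 V2 by auto
      then show "prob (a \<inter> b) = prob a * prob b" by (auto simp: prob_space)
    qed
  qed
  obtain \<mu> where \<mu>: "\<And>x0 \<mu>0 C0. gaussian M x0 \<mu>0 C0 \<Longrightarrow> C0 \<in> pd_mats \<Longrightarrow> indep_of_noise M x0 ?w \<Longrightarrow>
      (\<lambda>k. \<integral>\<omega>. state F x0 ?w k \<omega> \<partial>M) \<longlonglongrightarrow> \<mu>"
    using mss M W unfolding mean_square_stable_def by blast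
  have pow: "(\<lambda>k. ((*v) F ^^ k) \<mu>0) \<longlonglongrightarrow> \<mu>" for \<mu>0
  proof -
    let ?x0 = "\<lambda>\<omega>. \<mu>0 + Z \<omega>"
    have G: "gaussian M ?x0 \<mu>0 (mat 1)" by (rule Z)
    have "b \<bullet> expectation ?x0 = b \<bullet> \<mu>0" for b
      using gaussian_inner_moments(2)[OF G, of b]
        integral_bounded_linear[OF bounded_linear_inner_right
          square_integrable_imp_integrable[OF gaussian_square_integrable[OF G]], of b]
      by simp
    then have "expectation ?x0 = \<mu>0" by (metis vector_eq_ldot)
    then have "(\<integral>\<omega>. state F ?x0 ?w k \<omega> \<partial>M) = ((*v) F ^^ k) \<mu>0" for k
    proof (induction k)
      case (Suc k)
      show ?case using Suc.IH[OF Suc.prems] state_mean_recursion[OF M G W, of F k] by simp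
    qed simp
    moreover have "(mat 1 :: real^'n^'n) \<in> pd_mats" by (simp add: pd_mats_def)
    ultimately show ?thesis
      using \<mu>[OF G _ ind] G by (simp add: gaussian_def)
  qed
  have "((*v) F ^^ k) 0 = 0" for k by (induction k) auto
  then have "\<mu> = 0" using pow[of 0] by (simp add: LIMSEQ_const_iff)
  then show ?thesis using pow by (simp add: power_stable_def)
qed

lemma mean_square_stable_iff: "mean_square_stable F \<longleftrightarrow> power_stable F"
  using power_stable_imp_mean_square_stable mean_square_stable_imp_power_stable by blast

text \<open>Both readings of the cone are treated. For \<open>pd_mats\<close> the claims about
  optimal points hold because there is no feasible point; for \<open>psd_mats\<close> an optimal
  point exists. The threshold constructed in the proof depends on the system and cost matrices, not
  on the distributions.\<close>

theorem proposition1: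
  fixes A :: "real^'n^'n" and B :: "real^'m^'n"
    and Q sqrtQ :: "real^'n^'n" and R :: "real^'m^'m" and W :: "real^('n + 'm)^('n + 'm)"
    and \<mu>0 :: "real^'n" and \<Sigma>0 \<Sigma> X0 :: "real^'n^'n"
    and M :: "'a measure" and x0 :: "'a \<Rightarrow> real^'n" and w :: "nat \<Rightarrow> 'a \<Rightarrow> real^'n"
  assumes "Q \<in> psd_mats" and "R \<in> pd_mats"
    and "stabilizable A B"
    and "is_psd_sqrt Q sqrtQ" and "detectable A sqrtQ"
    and "W = block_diag Q R"
    and "\<Sigma>0 \<in> pd_mats" and "\<Sigma> \<in> psd_mats"
    and "X0 = \<Sigma>0 + outer \<mu>0 \<mu>0"
    and "prob_space M"
    and "gaussian M x0 \<mu>0 \<Sigma>0" and "gaussian_noise M w \<Sigma>" and "indep_of_noise M x0 w"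
  shows "\<exists>r0<1. \<forall>r. 0 < r \<and> r0 < r \<and> r < 1 \<longrightarrow>
    (\<exists>!Lstar. slq_optimal M A B W r x0 w Lstar) \<and>
    (\<forall>K \<in> {pd_mats, psd_mats}.
       (\<forall>Sp Lp Lstar. primal_optimal K A B W X0 \<Sigma> r (Sp, Lp) \<and> slq_optimal M A B W r x0 w Lstar \<longrightarrow>
          trace (W ** Sp) = slq_cost M A B W r x0 w Lstar \<and> Lp = Lstar) \<and>
       (\<forall>p q. primal_optimal K A B W X0 \<Sigma> r p \<and> primal_optimal K A B W X0 \<Sigma> r q \<longrightarrow> p = q)) \<and>
    (\<exists>p. primal_optimal psd_mats A B W X0 \<Sigma> r p)"
proof -
  note Q = \<open>Q \<in> psd_mats\<close> and R = \<open>R \<in> pd_mats\<close>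
  obtain K0 where K0: "power_stable (A + B ** K0)"
    using \<open>stabilizable A B\<close> schur_stable_imp_power_stable by (auto simp: stabilizable_def)
  obtain G where G: "power_stable (A + G ** sqrtQ)"
    using \<open>detectable A sqrtQ\<close> schur_stable_imp_power_stable by (auto simp: detectable_def)
  have QC: "Q = transpose sqrtQ ** sqrtQ"
    using \<open>is_psd_sqrt Q sqrtQ\<close> by (simp add: is_psd_sqrt_def psd_mats_def)
  obtain P0 where P0: "P0 = transpose (A + B ** K0) ** P0 ** (A + B ** K0) + stage_cost Q R K0"
    using stein_equation_solvable[OF K0] by blast
  \<comment> \<open>The bound shared by all discount factors, taken from the undiscounted cost of
    \<open>K0\<close>.\<close>
  obtain p where p: "0 < p" "\<And>x. x \<bullet> (P0 *v x) \<le> p * (x \<bullet> x)"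
    using matrix_quadratic_bound by blast
  obtain r0 where r0: "r0 < 1" "\<And>r P L. r0 < r \<Longrightarrow> 0 < r \<Longrightarrow> r < 1 \<Longrightarrow> riccati r A B Q R P L \<Longrightarrow>
     (\<And>x. x \<bullet> (P *v x) \<le> p * (x \<bullet> x)) \<Longrightarrow> power_stable (A + B ** L)"
    using riccati_stable_near_one[OF G QC R, of p B] p(1) by (metis less_imp_le)
  show ?thesis
  proof (intro exI[of _ r0] conjI[OF r0(1)] allI impI, elim conjE)
    fix r assume r: "0 < r" "r0 < r" "r < 1"
    have rle: "0 \<le> r" "r \<le> 1" using r by auto
    obtain P L where ric: "riccati r A B Q R P L" and PP0: "\<And>x. x \<bullet> (P *v x) \<le> x \<bullet> (P0 *v x)"
      using riccati_exists[OF Q R rle K0 P0] by blast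
    have stabL: "power_stable (A + B ** L)"
      using r ric PP0 p(2) by (intro r0(2)) (auto intro: order_trans)
    let ?X = "X0 + (r / (1 - r)) *\<^sub>R \<Sigma>"
    let ?F = "\<lambda>L'. A + B ** L'"
    let ?eq = "\<lambda>L' Y. Y = r *\<^sub>R (?F L' ** Y ** transpose (?F L')) + ?X"
    have X: "?X \<in> psd_mats"
      unfolding \<open>X0 = _\<close> using r \<open>\<Sigma> \<in> psd_mats\<close> pd_imp_psd[OF \<open>\<Sigma>0 \<in> pd_mats\<close>]
      by (intro psd_add psd_scaleR outer_psd) auto
    have XS: "?X - \<Sigma>0 \<in> psd_mats"
    proof -
      have "outer \<mu>0 \<mu>0 + (r / (1 - r)) *\<^sub>R \<Sigma> \<in> psd_mats"
        using r \<open>\<Sigma> \<in> psd_mats\<close> by (intro psd_add psd_scaleR outer_psd) auto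
      then show ?thesis by (simp add: \<open>X0 = _\<close> add.assoc)
    qed
    have YS: "Y - \<Sigma>0 \<in> psd_mats" if "?eq L' Y" "Y \<in> psd_mats" for L' Y
    proof -
      have "r *\<^sub>R (?F L' ** Y ** transpose (?F L')) + (?X - \<Sigma>0) \<in> psd_mats"
        using rle that(2) by (intro psd_add[OF _ XS] psd_scaleR psd_congruence_transpose)
      then show ?thesis by (subst that(1)) (simp add: add_diff_eq)
    qed
    \<comment> \<open>Covariances are propagated by \<open>?F L'\<close> on the left, so the Stein
      lemma is applied to the transposed closed loop.\<close>
    have ex: "\<exists>Y \<in> psd_mats. ?eq L' Y" and uniq: "?eq L' Y \<Longrightarrow> ?eq L' Y' \<Longrightarrow> Y = Y'"
      if "power_stable (?F L')" for L' Y Y'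
      using discounted_stein_equation[OF power_stable_transpose[OF that] rle, of ?X] X
      unfolding transpose_transpose by metis+
    let ?J = "trace (P ** ?X)" and ?c = "\<lambda>L' Y. trace (stage_cost Q R L' ** Y)"
    note opt = riccati_optimal[OF ric Q R rle(1)]
    have cost: "slq_cost M A B W r x0 w L' = ?c L' Y" if "power_stable (?F L')" "?eq L' Y" for L' Y
      unfolding \<open>W = _\<close>
      by (rule slq_cost_eq_trace[OF \<open>prob_space M\<close> \<open>gaussian M x0 \<mu>0 \<Sigma>0\<close> \<open>gaussian_noise M w \<Sigma>\<close>
            \<open>indep_of_noise M x0 w\<close> that(1) r(1,3) that(2)[unfolded \<open>X0 = _\<close>]])
    have gains: "L' \<in> stabilizing_gains A B \<longleftrightarrow> power_stable (?F L')" for L'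
      by (simp add: stabilizing_gains_def mean_square_stable_iff)
    have costL: "slq_cost M A B W r x0 w L = ?J"
    proof -
      obtain Y where Y: "?eq L Y" "Y \<in> psd_mats" using ex[OF stabL] by blast
      show ?thesis unfolding cost[OF stabL Y(1)] by (rule opt(2)[OF Y refl])
    qed
    have cost_ge: "?J \<le> slq_cost M A B W r x0 w L'" if L': "power_stable (?F L')" for L'
    proof -
      obtain Y where Y: "?eq L' Y" "Y \<in> psd_mats" using ex[OF L'] by blast
      show ?thesis unfolding cost[OF L' Y(1)] by (rule opt(1)[OF Y])
    qed
    have cost_eq: "L' = L" if L': "power_stable (?F L')" and le: "slq_cost M A B W r x0 w L' \<le> ?J" for L'
    proof -
      obtain Y where Y: "?eq L' Y" "Y \<in> psd_mats" using ex[OF L'] by blast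
      have "?c L' Y \<le> ?J" using le unfolding cost[OF L' Y(1)] .
      then show ?thesis by (rule opt(3)[OF Y _ \<open>\<Sigma>0 \<in> pd_mats\<close> YS[OF Y]])
    qed
    have slq: "slq_optimal M A B W r x0 w L' \<longleftrightarrow> L' = L" for L'
      unfolding slq_optimal_def is_arg_min_def gains
      using cost_ge cost_eq costL stabL by (metis not_less)
    obtain Ys where Ys: "?eq L Ys" "Ys \<in> psd_mats" using ex[OF stabL] by blast
    let ?S = "Lbar L ** Ys ** transpose (Lbar L)"
    note feas = primal_feasible_psd_iff[OF X rle(1), of A B]
    have feasL: "primal_feasible psd_mats A B X0 \<Sigma> r (?S, L)" using Ys by (auto simp: feas)
    have objL: "trace (W ** ?S) = ?J"
      unfolding \<open>W = _\<close> trace_block_diag_Lbar using opt(2)[OF Ys] by simp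
    have obj_ge: "?J \<le> trace (W ** S)"
      and obj_eq: "trace (W ** S) \<le> ?J \<Longrightarrow> S = ?S \<and> L' = L"
      if S: "primal_feasible psd_mats A B X0 \<Sigma> r (S, L')" for S L'
    proof -
      \<comment> \<open>The gain \<open>L'\<close> may fail to be stabilizing, so \<open>Y\<close>
        has to come from feasibility and not from \<open>ex\<close>.\<close>
      obtain Y where Y: "Y \<in> psd_mats" "?eq L' Y" and S: "S = Lbar L' ** Y ** transpose (Lbar L')"
        using S unfolding feas by blast
      have WS: "trace (W ** S) = ?c L' Y" unfolding S \<open>W = _\<close> by (rule trace_block_diag_Lbar)
      show "?J \<le> trace (W ** S)" unfolding WS by (rule opt(1)[OF Y(2,1)])
      assume "trace (W ** S) \<le> ?J"
      then have L': "L' = L"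
        unfolding WS by (rule opt(3)[OF Y(2,1) _ \<open>\<Sigma>0 \<in> pd_mats\<close> YS[OF Y(2,1)]])
      have "?eq L Y" using Y(2) unfolding L' .
      \<comment> \<open>Uniqueness of \<open>Y\<close> becomes available only here, once the gain is
        known to be the stabilizing \<open>L\<close>.\<close>
      then have "Y = Ys" using Ys(1) by (rule uniq[OF stabL])
      then show "S = ?S \<and> L' = L" unfolding S L' by simp
    qed
    have primal: "primal_optimal psd_mats A B W X0 \<Sigma> r q \<longleftrightarrow> q = (?S, L)" for q
    proof
      assume q: "primal_optimal psd_mats A B W X0 \<Sigma> r q"
      obtain S L' where SL: "q = (S, L')" by (cases q)
      have "primal_feasible psd_mats A B X0 \<Sigma> r (S, L')" "\<not> trace (W ** ?S) < trace (W ** S)"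
        using q feasL unfolding SL primal_optimal_def is_arg_min_def by auto
      then show "q = (?S, L)" unfolding SL objL not_less prod.inject by (rule obj_eq)
    next
      assume q: "q = (?S, L)"
      have "\<not> trace (W ** S) < trace (W ** ?S)"
        if "primal_feasible psd_mats A B X0 \<Sigma> r (S, L')" for S L'
        unfolding objL not_less using that by (rule obj_ge)
      then show "primal_optimal psd_mats A B W X0 \<Sigma> r q"
        unfolding q primal_optimal_def is_arg_min_def using feasL by auto
    qed
    have primal_pd: "\<not> primal_optimal pd_mats A B W X0 \<Sigma> r q" for q
      unfolding primal_optimal_def is_arg_min_def
      by (cases q) (simp add: primal_infeasible_pd)
    show "(\<exists>!Lstar. slq_optimal M A B W r x0 w Lstar) \<and>
      (\<forall>K \<in> {pd_mats, psd_mats}.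
       (\<forall>Sp Lp Lstar. primal_optimal K A B W X0 \<Sigma> r (Sp, Lp) \<and> slq_optimal M A B W r x0 w Lstar \<longrightarrow>
          trace (W ** Sp) = slq_cost M A B W r x0 w Lstar \<and> Lp = Lstar) \<and>
       (\<forall>p q. primal_optimal K A B W X0 \<Sigma> r p \<and> primal_optimal K A B W X0 \<Sigma> r q \<longrightarrow> p = q)) \<and>
      (\<exists>p. primal_optimal psd_mats A B W X0 \<Sigma> r p)"
      using primal_pd objL costL by (simp add: slq primal)
  qed
qed

end
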